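(* For every positive integer $r$ there is a constant $C_r>0$, depending only on $r$, such that the following holds for all positive integers $n,k$. Let $h\colon E(K_{rn}^{(r)})\to\mathbb{R}^k$ be such that $\|h(e)\|_1\le 1$ for all $e\in E(K_{rn}^{(r)})$. Then there is a perfect matching $M$ of $K_{rn}^{(r)}$ satisfying $f_h(M)\le C_r k^2$.
   Context: $K_{rn}^{(r)}$ is the complete $r$-uniform hypergraph on $rn$ vertices: its hyperedges are all $r$-element subsets of the vertex set. A perfect matching of an $r$-uniform hypergraph is a set of pairwise vertex-disjoint hyperedges covering every vertex. For a hypergraph $G$, a function $h\colon E(G)\to\mathbb{R}^k$ and a subhypergraph $G'$ of $G$, write $e(G)=|E(G)|$, $h(G')=\sum_{e\in E(G')}h(e)$, and $f_h(G')=\left\|h(G')-\frac{e(G')}{e(G)}h(G)\right\|_1$, where $\|\cdot\|_1$ is the $\ell_1$ norm on $\mathbb{R}^k$. Here $G=K_{rn}^{(r)}$. *)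

theory Defs
  imports Complex_Main "HOL-Library.Ramsey" "HOL-Library.Disjoint_Sets"
begin

text \<open>
  A hypergraph on a known vertex set is represented by its set of hyperedges, and
  a subhypergraph by a subset of those. The complete uniform hypergraph
  on \<open>N\<close> vertices has vertex set \<open>{..<N}\<close>.

  The dimension \<open>k\<close> is quantified after the constant in the theorem, so it cannot be
  a type. Vectors in \<open>k\<close>-dimensional real space are functions \<open>x :: nat \<Rightarrow> real\<close>
  of which only the coordinates \<open>x i\<close> with \<open>i < k\<close> are relevant.
\<close>

definition complete_hypergraph :: "nat \<Rightarrow> nat \<Rightarrow> nat set set" where
  "complete_hypergraph r N = nsets {..<N} r"

definition perfect_matching :: "'a set \<Rightarrow> 'a set set \<Rightarrow> 'a set set \<Rightarrow> bool" where
  "perfect_matching V G M \<longleftrightarrow> M \<subseteq> G \<and> disjoint M \<and> \<Union>M = V"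

definition l1_norm :: "nat \<Rightarrow> (nat \<Rightarrow> real) \<Rightarrow> real" where
  "l1_norm k x = (\<Sum>i<k. \<bar>x i\<bar>)"

definition edge_sum :: "('a set \<Rightarrow> nat \<Rightarrow> real) \<Rightarrow> 'a set set \<Rightarrow> nat \<Rightarrow> real" where
  "edge_sum h G = (\<lambda>i. \<Sum>e\<in>G. h e i)"

definition discrepancy ::
    "nat \<Rightarrow> ('a set \<Rightarrow> nat \<Rightarrow> real) \<Rightarrow> 'a set set \<Rightarrow> 'a set set \<Rightarrow> real" where
  "discrepancy k h G G' =
     l1_norm k (\<lambda>i. edge_sum h G' i - real (card G') / real (card G) * edge_sum h G i)"

end

(*
  Let the random permutation pi of the vertices carry a fixed perfect matching to M, and pair up the
  edges of M; in each pair the exchange of two vertices changes h(M) by a vector d_j. Different pairs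
  share no edge, so the sum of any subfamily of the d_j can be added to h(M).
  The mean of h(M) is the target q = e(M)/e(G) h(G). By a spectral gap inequality for random
  transpositions, the variance of u.h(M) and of u.(sum d_j) is at most a constant times
  E sum (u.d_j)^2, for every direction u: wherever the error is large, the exchanges give room
  to correct it. The form v -> sum (v.d_j)^2 concentrates around its mean uniformly in v, up to
  O(k |v|^2), so some pi is good for all directions at once. For this pi a least squares problem over
  the box |v_i| <= 1/8 writes q - h(M) as sum y_j d_j + O(k^2) with y_j = 1/2 + v.d_j in [0,1], and
  a linear dependence argument makes all but k of the y_j integral.
*)
theory Submission
  imports Defs "HOL-Combinatorics.Permutations" "HOL-Analysis.Convex"
begin

section \<open>Averages over permutations\<close>

text \<open>The comparison of variances holds only on average and for one direction at a time, while
  one permutation must serve all directions, among them those in which the exchanges are too small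
  for relative concentration. Such directions are given up in a controlled way: the mean form is
  regularised by \<open>c * k\<close> times the identity, and second moments then suffice, without
  tail bounds or nets. The price is \<open>c * k * dot k v v\<close>, where \<open>dot k v v\<close>
  is at most k / 64 on the box; this product is the origin of k^2. The box is dual to the l1 norm:
  an upper bound for \<open>dot k v e\<close> minus the quadratic form, valid on the whole box,
  becomes an l1 bound for the least squares residual. Coefficients centred at 1/2 can move both
  ways, so half of the total exchange is subtracted from the target beforehand. The constant depends
  on r, linearly, because the spectral gap counts r n positions while only n div 2 exchanges are
  available.\<close>

definition perm_avg :: "nat \<Rightarrow> ((nat \<Rightarrow> nat) \<Rightarrow> real) \<Rightarrow> real" where
  "perm_avg N f = (\<Sum>\<pi> | \<pi> permutes {..<N}. f \<pi>) / fact N"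

lemma perm_avg_const [simp]: "perm_avg N (\<lambda>_. c) = c"
  by (simp add: perm_avg_def card_permutations[of _ N])

lemma perm_avg_add: "perm_avg N (\<lambda>\<pi>. f \<pi> + g \<pi>) = perm_avg N f + perm_avg N g"
  by (simp add: perm_avg_def sum.distrib add_divide_distrib)

lemma perm_avg_diff: "perm_avg N (\<lambda>\<pi>. f \<pi> - g \<pi>) = perm_avg N f - perm_avg N g"
  by (simp add: perm_avg_def sum_subtractf diff_divide_distrib)

lemma perm_avg_cmult: "perm_avg N (\<lambda>\<pi>. c * f \<pi>) = c * perm_avg N f"
  by (simp add: perm_avg_def sum_distrib_left)

lemma perm_avg_sum: "perm_avg N (\<lambda>\<pi>. \<Sum>i\<in>I. f i \<pi>) = (\<Sum>i\<in>I. perm_avg N (f i))"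
  unfolding perm_avg_def by (subst sum.swap) (simp add: sum_divide_distrib)

lemma perm_avg_mono:
  assumes "\<And>\<pi>. \<pi> permutes {..<N} \<Longrightarrow> f \<pi> \<le> g \<pi>"
  shows "perm_avg N f \<le> perm_avg N g"
  unfolding perm_avg_def by (intro divide_right_mono sum_mono) (auto simp: assms)

lemma perm_avg_cong:
  assumes "\<And>\<pi>. \<pi> permutes {..<N} \<Longrightarrow> f \<pi> = g \<pi>"
  shows "perm_avg N f = perm_avg N g"
  unfolding perm_avg_def using assms by (metis (mono_tags, lifting) mem_Collect_eq sum.cong)

lemma perm_avg_nonneg:
  assumes "\<And>\<pi>. \<pi> permutes {..<N} \<Longrightarrow> 0 \<le> f \<pi>"
  shows "0 \<le> perm_avg N f"
  using perm_avg_mono[of N "\<lambda>_. 0" f] assms by simp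

lemma perm_avg_less_obtains:
  assumes "perm_avg N f < c"
  obtains \<pi> where "\<pi> permutes {..<N}" "f \<pi> < c"
  using perm_avg_mono[of N "\<lambda>_. c" f] assms by (metis not_less perm_avg_const)

lemma perm_avg_compose_right:
  assumes "\<sigma> permutes {..<N}"
  shows "perm_avg N (\<lambda>\<pi>. f (\<pi> \<circ> \<sigma>)) = perm_avg N f"
  unfolding perm_avg_def using sum_permutations_compose_right[OF assms, of f] by simp

lemma perm_avg_compose_left:
  assumes "\<sigma> permutes {..<N}"
  shows "perm_avg N (\<lambda>\<pi>. f (\<sigma> \<circ> \<pi>)) = perm_avg N f"
  unfolding perm_avg_def using setum_permutations_compose_left[OF assms, of f] by simp

text \<open>Conditioning on the value at \<open>N\<close>: since \<pi> fixes \<open>N\<close>,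
  \<open>transpose N b \<circ> \<pi>\<close> ranges over the permutations sending \<open>N\<close>
  to \<open>b\<close>.\<close>

lemma perm_avg_Suc_left:
  "perm_avg (Suc N) f =
     (\<Sum>b\<le>N. perm_avg N (\<lambda>\<pi>. f (transpose N b \<circ> \<pi>))) / real (Suc N)"
proof -
  have "{..<Suc N} = insert N {..<N}" by auto
  then have "(\<Sum>\<pi> | \<pi> permutes {..<Suc N}. f \<pi>) =
      (\<Sum>b\<in>insert N {..<N}. \<Sum>\<pi> | \<pi> permutes {..<N}. f (transpose N b \<circ> \<pi>))"
    using sum_over_permutations_insert[of "{..<N}" N f] by simp
  also have "insert N {..<N} = {..N}" by auto
  finally show ?thesis
    by (simp add: perm_avg_def sum_divide_distrib mult.commute del: o_apply)
qed

lemma perm_avg_inv: "perm_avg N (\<lambda>\<pi>. f (inv \<pi>)) = perm_avg N f"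
  unfolding perm_avg_def using sum_permutations_inverse[of f "{..<N}"] by simp

text \<open>Inversion turns the condition on the value at \<open>N\<close> into one on the position
  where the value \<open>N\<close> sits, which is \<open>b\<close> for
  \<open>\<pi> \<circ> transpose N b\<close>.\<close>

lemma perm_avg_Suc_right:
  "perm_avg (Suc N) f =
     (\<Sum>b\<le>N. perm_avg N (\<lambda>\<pi>. f (\<pi> \<circ> transpose N b))) / real (Suc N)"
proof -
  have "perm_avg N (\<lambda>\<pi>. f (inv (transpose N b \<circ> \<pi>))) =
        perm_avg N (\<lambda>\<pi>. f (\<pi> \<circ> transpose N b))" if "b \<le> N" for b
  proof -
    have "inv (transpose N b \<circ> \<pi>) = inv \<pi> \<circ> transpose N b" if "\<pi> permutes {..<N}" for \<pi>
      using that by (simp add: o_inv_distrib permutes_bij)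
    then have "perm_avg N (\<lambda>\<pi>. f (inv (transpose N b \<circ> \<pi>))) =
        perm_avg N (\<lambda>\<pi>. f (inv \<pi> \<circ> transpose N b))"
      by (intro perm_avg_cong) simp
    also have "\<dots> = perm_avg N (\<lambda>\<pi>. f (\<pi> \<circ> transpose N b))"
      using perm_avg_inv[of N "\<lambda>\<pi>. f (\<pi> \<circ> transpose N b)"] by simp
    finally show ?thesis .
  qed
  then show ?thesis
    using perm_avg_Suc_left[of N "\<lambda>\<pi>. f (inv \<pi>)"] perm_avg_inv[of "Suc N" f] by simp
qed

section \<open>Variance and the spectral gap of random transpositions\<close>

lemma perm_avg_variance:
  "perm_avg N (\<lambda>\<pi>. (f \<pi> - c)\<^sup>2) =
     perm_avg N (\<lambda>\<pi>. (f \<pi> - perm_avg N f)\<^sup>2) + (perm_avg N f - c)\<^sup>2"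
proof -
  have expand: "perm_avg N (\<lambda>\<pi>. (f \<pi> - a)\<^sup>2) =
      perm_avg N (\<lambda>\<pi>. (f \<pi>)\<^sup>2) - 2 * a * perm_avg N f + a\<^sup>2" for a
  proof -
    have "(\<lambda>\<pi>. (f \<pi> - a)\<^sup>2) = (\<lambda>\<pi>. ((f \<pi>)\<^sup>2 - 2 * a * f \<pi>) + a\<^sup>2)"
      by (auto simp: power2_eq_square algebra_simps)
    then show ?thesis
      by (simp only: perm_avg_add perm_avg_diff perm_avg_cmult perm_avg_const)
  qed
  show ?thesis
    unfolding expand by (simp add: power2_eq_square algebra_simps)
qed

lemma perm_avg_square_le: "(perm_avg N f)\<^sup>2 \<le> perm_avg N (\<lambda>\<pi>. (f \<pi>)\<^sup>2)"
  using perm_avg_variance[of N f 0] perm_avg_nonneg[of N "\<lambda>\<pi>. (f \<pi> - perm_avg N f)\<^sup>2"] by simp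

text \<open>
  A spectral gap inequality for random transpositions. Condition on the value \<open>b\<close> at
  the last position: the variance inside a class is handled by induction. The class mean differs
  from the total mean by an average of \<open>f \<pi> - f (\<pi> \<circ> transpose N j)\<close> over the class and over
  \<open>j \<le> N\<close>, as \<open>\<pi> \<circ> transpose N j\<close> is then a uniformly random permutation.
\<close>

lemma perm_avg_poincare:
  "perm_avg N (\<lambda>\<pi>. (f \<pi> - perm_avg N f)\<^sup>2) \<le>
     (\<Sum>j<N. (\<Sum>i<j. perm_avg N (\<lambda>\<pi>. (f \<pi> - f (\<pi> \<circ> transpose i j))\<^sup>2)) / real (Suc j))"
proof (induction N arbitrary: f)
  case 0
  have "\<pi> = id" if "\<pi> permutes {..<0}" for \<pi> :: "nat \<Rightarrow> nat"
    using that by simp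
  then have "perm_avg 0 g = g id" for g
    using perm_avg_cong[of 0 g "\<lambda>_. g id"] perm_avg_const[of 0 "g id"] by metis
  then show ?case by simp
next
  case (Suc N)
  define fb where "fb b = (\<lambda>\<pi>. f (transpose N b \<circ> \<pi>))" for b
  define G where "G b = perm_avg N (fb b)" for b
  define \<mu> where "\<mu> = perm_avg (Suc N) f"
  define en where "en i j = perm_avg (Suc N) (\<lambda>\<pi>. (f \<pi> - f (\<pi> \<circ> transpose i j))\<^sup>2)" for i j
  define enb where "enb b i j = perm_avg N (\<lambda>\<pi>. (fb b \<pi> - fb b (\<pi> \<circ> transpose i j))\<^sup>2)" for b i j
  have en: "en i j = (\<Sum>b\<le>N. enb b i j) / real (Suc N)" for i j
    unfolding en_def enb_def fb_def by (subst perm_avg_Suc_left) (simp add: o_assoc)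
  have IH: "perm_avg N (\<lambda>\<pi>. (fb b \<pi> - G b)\<^sup>2) \<le> (\<Sum>j<N. (\<Sum>i<j. enb b i j) / real (Suc j))" for b
    unfolding G_def enb_def by (rule Suc.IH)
  have G_dev: "(G b - \<mu>)\<^sup>2 \<le> (\<Sum>j\<le>N. enb b j N) / real (Suc N)" if b: "b \<le> N" for b
  proof -
    \<comment> \<open>Left multiplication by a transposition preserves the law, so averaging
      \<open>fb b\<close> over all permutations gives \<mu>, while \<open>G b\<close> averages the
      same function over those fixing \<open>N\<close>.\<close>
    have "\<mu> = perm_avg (Suc N) (fb b)"
      unfolding \<mu>_def fb_def using b
      by (intro perm_avg_compose_left[symmetric] permutes_swap_id) auto
    also have "\<dots> = (\<Sum>j\<le>N. perm_avg N (\<lambda>\<pi>. fb b (\<pi> \<circ> transpose N j))) / real (Suc N)"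
      by (rule perm_avg_Suc_right)
    finally have "G b - \<mu> =
        (\<Sum>j\<le>N. perm_avg N (\<lambda>\<pi>. fb b \<pi> - fb b (\<pi> \<circ> transpose N j))) / real (Suc N)"
      by (simp add: perm_avg_diff sum_subtractf G_def field_simps)
    then have "(G b - \<mu>)\<^sup>2 =
        (\<Sum>j\<le>N. perm_avg N (\<lambda>\<pi>. fb b \<pi> - fb b (\<pi> \<circ> transpose N j)))\<^sup>2 / (real (Suc N))\<^sup>2"
      by (simp add: power_divide)
    also have "\<dots> \<le> (real (Suc N) *
        (\<Sum>j\<le>N. (perm_avg N (\<lambda>\<pi>. fb b \<pi> - fb b (\<pi> \<circ> transpose N j)))\<^sup>2)) / (real (Suc N))\<^sup>2"
      using sum_squared_le_sum_of_squares[where I = "{..N}"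
          and f = "\<lambda>j. perm_avg N (\<lambda>\<pi>. fb b \<pi> - fb b (\<pi> \<circ> transpose N j))"]
      by (intro divide_right_mono) (auto simp: mult.commute)
    also have "\<dots> = (\<Sum>j\<le>N. (perm_avg N (\<lambda>\<pi>. fb b \<pi> - fb b (\<pi> \<circ> transpose N j)))\<^sup>2) / real (Suc N)"
      by (simp add: power2_eq_square)
    also have "\<dots> \<le> (\<Sum>j\<le>N. enb b j N) / real (Suc N)"
      unfolding enb_def
      by (intro divide_right_mono sum_mono)
        (auto simp: transpose_commute intro!: order_trans[OF perm_avg_square_le])
    finally show ?thesis .
  qed
  have "perm_avg (Suc N) (\<lambda>\<pi>. (f \<pi> - \<mu>)\<^sup>2) =
      (\<Sum>b\<le>N. perm_avg N (\<lambda>\<pi>. (fb b \<pi> - \<mu>)\<^sup>2)) / real (Suc N)"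
    unfolding fb_def by (rule perm_avg_Suc_left)
  also have "\<dots> = (\<Sum>b\<le>N. perm_avg N (\<lambda>\<pi>. (fb b \<pi> - G b)\<^sup>2) + (G b - \<mu>)\<^sup>2) / real (Suc N)"
    by (simp only: perm_avg_variance[of N _ \<mu>] G_def)
  also have "\<dots> \<le> (\<Sum>b\<le>N. (\<Sum>j<N. (\<Sum>i<j. enb b i j) / real (Suc j))
        + (\<Sum>j\<le>N. enb b j N) / real (Suc N)) / real (Suc N)"
    using IH G_dev by (intro divide_right_mono sum_mono add_mono) auto
  also have "\<dots> = (\<Sum>j<N. (\<Sum>i<j. en i j) / real (Suc j)) + (\<Sum>j\<le>N. en j N) / real (Suc N)"
  proof -
    have "(\<Sum>b\<le>N. \<Sum>j<N. (\<Sum>i<j. enb b i j) / real (Suc j)) / real (Suc N) =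
        (\<Sum>j<N. \<Sum>b\<le>N. (\<Sum>i<j. enb b i j) / real (Suc j) / real (Suc N))"
      unfolding sum_divide_distrib by (rule sum.swap)
    also have "\<dots> = (\<Sum>j<N. (\<Sum>i<j. en i j) / real (Suc j))"
    proof (rule sum.cong[OF refl])
      fix j
      have "(\<Sum>i<j. en i j) = (\<Sum>b\<le>N. \<Sum>i<j. enb b i j / real (Suc N))"
        unfolding en sum_divide_distrib by (rule sum.swap)
      then show "(\<Sum>b\<le>N. (\<Sum>i<j. enb b i j) / real (Suc j) / real (Suc N)) = (\<Sum>i<j. en i j) / real (Suc j)"
        by (simp add: mult.commute del: of_nat_Suc flip: sum_divide_distrib)
    qed
    finally have 1: "(\<Sum>b\<le>N. \<Sum>j<N. (\<Sum>i<j. enb b i j) / real (Suc j)) / real (Suc N) =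
        (\<Sum>j<N. (\<Sum>i<j. en i j) / real (Suc j))" .
    have "(\<Sum>j\<le>N. en j N) = (\<Sum>b\<le>N. \<Sum>j\<le>N. enb b j N / real (Suc N))"
      unfolding en sum_divide_distrib by (rule sum.swap)
    then have 2: "(\<Sum>b\<le>N. (\<Sum>j\<le>N. enb b j N) / real (Suc N)) = (\<Sum>j\<le>N. en j N)"
      by (simp add: sum_divide_distrib)
    show ?thesis
      by (simp add: sum.distrib add_divide_distrib 1 2 del: of_nat_Suc)
  qed
  \<comment> \<open>The term j = N vanishes because \<open>transpose N N\<close> is the
    identity.\<close>
  also have "(\<Sum>j\<le>N. en j N) = (\<Sum>i<N. en i N)"
    by (simp add: en_def flip: lessThan_Suc_atMost)
  finally show ?case
    by (simp only: \<mu>_def en_def sum.lessThan_Suc)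
qed

text \<open>In \<open>perm_avg_poincare\<close> the j terms of weight 1 / (j + 1) add up to at most
  \<open>K\<close>, so the loss is a factor \<open>N\<close> and not the number of pairs. A linear
  loss is what a sum over n div 2 exchanges can match.\<close>

lemma perm_avg_variance_le:
  assumes "\<And>i j. i < j \<Longrightarrow> j < N \<Longrightarrow> perm_avg N (\<lambda>\<pi>. (f \<pi> - f (\<pi> \<circ> transpose i j))\<^sup>2) \<le> K"
    and "0 \<le> K"
  shows "perm_avg N (\<lambda>\<pi>. (f \<pi> - perm_avg N f)\<^sup>2) \<le> real N * K"
proof -
  have "(\<Sum>i<j. perm_avg N (\<lambda>\<pi>. (f \<pi> - f (\<pi> \<circ> transpose i j))\<^sup>2)) / real (Suc j) \<le> K"
    if "j < N" for j
  proof -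
    have "(\<Sum>i<j. perm_avg N (\<lambda>\<pi>. (f \<pi> - f (\<pi> \<circ> transpose i j))\<^sup>2)) \<le> (\<Sum>i<j. K)"
      using assms(1) that by (intro sum_mono) auto
    also have "\<dots> \<le> K * real (Suc j)"
      using assms(2) by (simp add: algebra_simps)
    finally show ?thesis by (simp add: divide_le_eq)
  qed
  then have "(\<Sum>j<N. (\<Sum>i<j. perm_avg N (\<lambda>\<pi>. (f \<pi> - f (\<pi> \<circ> transpose i j))\<^sup>2)) / real (Suc j)) \<le> (\<Sum>j<N. K)"
    by (intro sum_mono) auto
  then show ?thesis using perm_avg_poincare[of N f] by simp
qed

section \<open>Symmetry between lists of positions\<close>

lemma permutes_extending_injection:
  assumes "inj_on s A" "inj_on s' A" "s ` A \<subseteq> V" "s' ` A \<subseteq> V" "finite V"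
  obtains \<sigma> where "\<sigma> permutes V" "\<And>t. t \<in> A \<Longrightarrow> \<sigma> (s t) = s' t"
proof -
  have fin: "finite (s ` A)" "finite (s' ` A)"
    using assms finite_subset by blast+
  have "card (V - s ` A) = card (V - s' ` A)"
    using assms fin by (simp add: card_Diff_subset card_image)
  then obtain g where g: "bij_betw g (V - s ` A) (V - s' ` A)"
    using finite_same_card_bij[of "V - s ` A" "V - s' ` A"] assms(5) by blast
  define f where "f = s' \<circ> the_inv_into A s"
  have f: "bij_betw f (s ` A) (s' ` A)"
    unfolding f_def using assms(1,2)
    by (intro bij_betw_trans[OF bij_betw_the_inv_into]) (auto simp: bij_betw_def)
  define \<sigma> where "\<sigma> x = (if x \<in> s ` A then f x else if x \<in> V then g x else x)" for x
  have "bij_betw \<sigma> (s ` A \<union> (V - s ` A)) (s' ` A \<union> (V - s' ` A))"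
  proof (rule bij_betw_combine)
    show "bij_betw \<sigma> (s ` A) (s' ` A)"
      using f by (rule bij_betw_cong[THEN iffD1, rotated]) (simp add: \<sigma>_def)
    show "bij_betw \<sigma> (V - s ` A) (V - s' ` A)"
      using g by (rule bij_betw_cong[THEN iffD1, rotated]) (simp add: \<sigma>_def)
  qed auto
  then have "bij_betw \<sigma> V V"
    using assms(3,4) by (simp add: Un_absorb1)
  moreover have "\<sigma> x = x" if "x \<notin> V" for x
    using that assms(3) by (auto simp: \<sigma>_def)
  ultimately have "\<sigma> permutes V"
    by (rule bij_imp_permutes)
  moreover have "\<sigma> (s t) = s' t" if "t \<in> A" for t
    using that assms(1) by (simp add: \<sigma>_def f_def the_inv_into_f_f)
  ultimately show thesis using that by blast
qed

text \<open>A permutation carrying \<open>s\<close> to \<open>s'\<close> on \<open>A\<close> acts by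
  right multiplication, which preserves the uniform law. This exchangeability lets one list of
  distinct positions replace another.\<close>

lemma perm_avg_injection_cong:
  assumes "inj_on s A" "inj_on s' A" "s ` A \<subseteq> {..<N}" "s' ` A \<subseteq> {..<N}"
    and local: "\<And>x y. (\<And>t. t \<in> A \<Longrightarrow> x t = y t) \<Longrightarrow> \<psi> x = \<psi> y"
  shows "perm_avg N (\<lambda>\<pi>. \<psi> (\<pi> \<circ> s)) = perm_avg N (\<lambda>\<pi>. \<psi> (\<pi> \<circ> s'))"
proof -
  obtain \<sigma> where \<sigma>: "\<sigma> permutes {..<N}" "\<And>t. t \<in> A \<Longrightarrow> \<sigma> (s t) = s' t"
    using permutes_extending_injection[OF assms(1-4)] by auto
  have "perm_avg N (\<lambda>\<pi>. \<psi> (\<pi> \<circ> s)) = perm_avg N (\<lambda>\<pi>. \<psi> (\<pi> \<circ> \<sigma> \<circ> s))"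
    using perm_avg_compose_right[OF \<sigma>(1), of "\<lambda>\<pi>. \<psi> (\<pi> \<circ> s)"] by simp
  also have "\<dots> = perm_avg N (\<lambda>\<pi>. \<psi> (\<pi> \<circ> s'))"
    using \<sigma>(2) by (intro perm_avg_cong local) simp
  finally show ?thesis .
qed

section \<open>Linear algebra in coordinates\<close>

definition dot :: "nat \<Rightarrow> (nat \<Rightarrow> real) \<Rightarrow> (nat \<Rightarrow> real) \<Rightarrow> real" where
  "dot k u v = (\<Sum>i<k. u i * v i)"

lemma dot_commute: "dot k u v = dot k v u"
  by (simp add: dot_def mult.commute)

lemma dot_add_left: "dot k (\<lambda>i. u i + v i) w = dot k u w + dot k v w"
  by (simp add: dot_def algebra_simps sum.distrib)

lemma dot_diff_right: "dot k w (\<lambda>i. u i - v i) = dot k w u - dot k w v"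
  by (simp add: dot_def algebra_simps sum_subtractf)

lemma dot_scale_right: "dot k w (\<lambda>i. c * u i) = c * dot k w u"
  by (simp add: dot_def algebra_simps sum_distrib_left)

lemma dot_scale_left: "dot k (\<lambda>i. c * u i) w = c * dot k u w"
  by (simp add: dot_def algebra_simps sum_distrib_left)

lemma dot_sum_right: "dot k w (\<lambda>i. \<Sum>j\<in>J. u j i) = (\<Sum>j\<in>J. dot k w (u j))"
  unfolding dot_def sum_distrib_left by (rule sum.swap)

lemma dot_sum_left: "dot k (\<lambda>i. \<Sum>j\<in>J. u j i) w = (\<Sum>j\<in>J. dot k (u j) w)"
  by (simp only: dot_commute[of k _ w] dot_sum_right)

lemma dot_cong:
  assumes "\<And>i. i < k \<Longrightarrow> u i = u' i" "\<And>i. i < k \<Longrightarrow> v i = v' i"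
  shows "dot k u v = dot k u' v'"
  using assms by (simp add: dot_def)

lemma dot_self_nonneg: "0 \<le> dot k u u"
  by (simp add: dot_def sum_nonneg)

lemma dot_cauchy_schwarz: "(dot k u v)\<^sup>2 \<le> dot k u u * dot k v v"
  using Cauchy_Schwarz_ineq_sum[of u v "{..<k}"] by (simp add: dot_def power2_eq_square)

lemma abs_dot_le:
  assumes "\<And>i. i < k \<Longrightarrow> \<bar>u i\<bar> \<le> c"
  shows "\<bar>dot k u v\<bar> \<le> c * l1_norm k v"
proof -
  have "\<bar>dot k u v\<bar> \<le> (\<Sum>i<k. \<bar>u i\<bar> * \<bar>v i\<bar>)"
    unfolding dot_def by (rule order_trans[OF sum_abs]) (simp add: abs_mult)
  also have "\<dots> \<le> (\<Sum>i<k. c * \<bar>v i\<bar>)"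
    using assms by (intro sum_mono mult_right_mono) auto
  finally show ?thesis by (simp add: l1_norm_def sum_distrib_left)
qed

lemma l1_norm_triangle_diff: "l1_norm k (\<lambda>i. u i - v i) \<le> l1_norm k u + l1_norm k v"
  unfolding l1_norm_def sum.distrib[symmetric] by (intro sum_mono) auto

lemma l1_norm_nonneg: "0 \<le> l1_norm k u"
  by (simp add: l1_norm_def sum_nonneg)

lemma l1_norm_scale: "l1_norm k (\<lambda>i. c * u i) = \<bar>c\<bar> * l1_norm k u"
  by (simp add: l1_norm_def sum_distrib_left abs_mult)

lemma l1_norm_sum: "l1_norm k (\<lambda>i. \<Sum>j\<in>J. u j i) \<le> (\<Sum>j\<in>J. l1_norm k (u j))"
proof -
  have "l1_norm k (\<lambda>i. \<Sum>j\<in>J. u j i) \<le> (\<Sum>i<k. \<Sum>j\<in>J. \<bar>u j i\<bar>)"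
    unfolding l1_norm_def by (intro sum_mono sum_abs)
  also have "\<dots> = (\<Sum>j\<in>J. l1_norm k (u j))"
    unfolding l1_norm_def by (rule sum.swap)
  finally show ?thesis .
qed

lemma dot_self_le_l1_norm: "dot k u u \<le> (l1_norm k u)\<^sup>2"
proof -
  have "dot k u u = (\<Sum>i<k. \<bar>u i\<bar> * \<bar>u i\<bar>)" by (simp add: dot_def)
  also have "\<dots> \<le> (\<Sum>i<k. \<bar>u i\<bar> * l1_norm k u)"
    unfolding l1_norm_def by (intro sum_mono mult_left_mono member_le_sum) auto
  finally show ?thesis by (simp add: l1_norm_def power2_eq_square sum_distrib_right)
qed

section \<open>Gram-Schmidt for a positive definite form\<close>

locale pos_def_form =
  fixes k :: nat and A :: "(nat \<Rightarrow> real) \<Rightarrow> (nat \<Rightarrow> real) \<Rightarrow> real"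
  assumes add_scale: "A (\<lambda>i. u i + c * v i) w = A u w + c * A v w"
    and sym: "A u v = A v u"
    and pos: "(\<exists>i<k. u i \<noteq> 0) \<Longrightarrow> 0 < A u u"
begin

lemma zero_left: "A (\<lambda>_. 0) w = 0"
  using add_scale[of "\<lambda>_. 0" "-1" "\<lambda>_. 0" w] by simp

lemma lincomb_left: "finite I \<Longrightarrow> A (\<lambda>i. \<Sum>a\<in>I. c a * u a i) w = (\<Sum>a\<in>I. c a * A (u a) w)"
proof (induction I rule: finite_induct)
  case empty
  then show ?case using zero_left by simp
next
  case (insert a I)
  then show ?case
    using add_scale[of "\<lambda>i. \<Sum>a\<in>I. c a * u a i" "c a" "u a" w] by (simp add: add.commute)
qed

lemma lincomb_right: "finite I \<Longrightarrow> A w (\<lambda>i. \<Sum>a\<in>I. c a * u a i) = (\<Sum>a\<in>I. c a * A w (u a))"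
  using lincomb_left[of I c u w] by (simp add: sym)

text \<open>Gram-Schmidt on the standard unit vectors, one coordinate at a time. Vectors are
  functions on all naturals, so the supports are kept below \<open>j\<close>, and spanning is an
  equation of whole functions.\<close>

lemma orthonormal_initial:
  assumes "j \<le> k"
  shows "\<exists>b. (\<forall>a<j. \<forall>i\<ge>j. b a i = 0) \<and> (\<forall>a<j. \<forall>a'<j. A (b a) (b a') = (if a = a' then 1 else 0)) \<and>
    (\<forall>v. (\<forall>i\<ge>j. v i = 0) \<longrightarrow> (\<exists>\<alpha>. v = (\<lambda>i. \<Sum>a<j. \<alpha> a * b a i)))"
  using assms
proof (induction j)
  case 0
  then show ?case by auto
next
  case (Suc j)
  then obtain b where supp: "\<forall>a<j. \<forall>i\<ge>j. b a i = 0"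
    and on: "\<forall>a<j. \<forall>a'<j. A (b a) (b a') = (if a = a' then 1 else 0)"
    and span: "\<forall>v. (\<forall>i\<ge>j. v i = 0) \<longrightarrow> (\<exists>\<alpha>. v = (\<lambda>i. \<Sum>a<j. \<alpha> a * b a i))"
    by auto
  \<comment> \<open>\<open>p\<close> is the component of the unit vector \<open>e\<close> along the
    earlier \<open>b a\<close>. The residual \<open>w\<close> still has coordinate 1 at
    \<open>j\<close>, so positivity of the form applies to it.\<close>
  define e where "e = (\<lambda>i. if i = j then 1 else 0 :: real)"
  define p where "p = (\<lambda>i. \<Sum>a<j. A e (b a) * b a i)"
  define w where "w = (\<lambda>i. e i + (-1) * p i)"
  have p_supp: "p i = 0" if "i \<ge> j" for i
    using supp that by (simp add: p_def)
  have wj: "w j = 1" using p_supp by (simp add: w_def e_def)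
  have w_supp: "w i = 0" if "i \<ge> Suc j" for i using p_supp that by (simp add: w_def e_def)
  have "A w w > 0" using pos[of w] wj Suc.prems by (metis Suc_le_lessD zero_neq_one)
  define s where "s = sqrt (A w w)"
  have s: "s > 0" "s * s = A w w" using \<open>A w w > 0\<close> by (simp_all add: s_def)
  have orth: "A w (b a') = 0" if "a' < j" for a'
  proof -
    have "A p (b a') = (\<Sum>a<j. A e (b a) * A (b a) (b a'))"
      unfolding p_def by (rule lincomb_left) simp
    also have "\<dots> = (\<Sum>a<j. if a = a' then A e (b a) else 0)"
      using on that by (intro sum.cong) auto
    also have "\<dots> = A e (b a')" using that by simp
    finally show ?thesis unfolding w_def by (subst add_scale) simp
  qed
  define b' where "b' = b(j := (\<lambda>i. w i / s))"
  have b'j: "A (b' j) v = A w v / s" for v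
    using add_scale[of "\<lambda>_. 0" "1 / s" w v] zero_left[of v] by (simp add: b'_def)
  have b'j': "A v (b' j) = A w v / s" for v
    using b'j[of v] sym by simp
  have b'a: "b' a = b a" if "a < j" for a using that by (simp add: b'_def)
  have "A (b' a) (b' a') = (if a = a' then 1 else 0)" if "a < Suc j" "a' < Suc j" for a a'
  proof -
    consider "a < j" "a' < j" | "a = j" "a' < j" | "a < j" "a' = j" | "a = j" "a' = j"
      using \<open>a < Suc j\<close> \<open>a' < Suc j\<close> by linarith
    then show ?thesis
    proof cases
      case 1 then show ?thesis using on b'a by simp
    next
      case 2 then show ?thesis using orth[of a'] b'a[of a'] b'j by simp
    next
      case 3 then show ?thesis using orth[of a] b'a[of a] b'j' by simp
    next
      case 4
      have "A (b' j) (b' j) = A w (b' j) / s" by (rule b'j)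
      also have "A w (b' j) = A w w / s" by (rule b'j')
      also have "A w w / s / s = 1" unfolding s(2)[symmetric] using s(1) by simp
      finally show ?thesis using 4 by simp
    qed
  qed
  moreover have "\<forall>a<Suc j. \<forall>i\<ge>Suc j. b' a i = 0"
    using supp w_supp by (auto simp: b'_def less_Suc_eq)
  moreover have "\<exists>\<alpha>. v = (\<lambda>i. \<Sum>a<Suc j. \<alpha> a * b' a i)" if v: "\<forall>i\<ge>Suc j. v i = 0" for v
  proof -
    \<comment> \<open>Subtracting \<open>v j * w\<close> clears coordinate \<open>j\<close>, so the
      induction hypothesis covers the rest; the factor \<open>s\<close> below undoes the
      normalisation of \<open>b' j\<close>.\<close>
    define v' where "v' = (\<lambda>i. v i - v j * w i)"
    have "\<forall>i\<ge>j. v' i = 0"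
      using v w_supp wj by (metis Suc_leI le_neq_implies_less mult_cancel_left1 mult_zero_right
          right_minus_eq v'_def)
    then obtain \<alpha> where \<alpha>: "v' = (\<lambda>i. \<Sum>a<j. \<alpha> a * b a i)" using span by blast
    have "v i = (\<Sum>a<Suc j. (\<alpha>(j := v j * s)) a * b' a i)" for i
    proof -
      have "v i = v' i + v j * w i" by (simp add: v'_def)
      also have "v' i = (\<Sum>a<j. (\<alpha>(j := v j * s)) a * b' a i)"
        by (simp add: \<alpha> b'_def)
      finally show ?thesis using s by (simp add: b'_def)
    qed
    then show ?thesis by blast
  qed
  ultimately show ?case by blast
qed

lemma orthonormal_basis_obtains:
  obtains b where "\<And>a a'. a < k \<Longrightarrow> a' < k \<Longrightarrow> A (b a) (b a') = (if a = a' then 1 else 0)"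
    "\<And>v. \<exists>\<alpha>. \<forall>i<k. v i = (\<Sum>a<k. \<alpha> a * b a i)"
proof -
  obtain b where on: "\<forall>a<k. \<forall>a'<k. A (b a) (b a') = (if a = a' then 1 else 0)"
    and span: "\<forall>v. (\<forall>i\<ge>k. v i = 0) \<longrightarrow> (\<exists>\<alpha>. v = (\<lambda>i. \<Sum>a<k. \<alpha> a * b a i))"
    using orthonormal_initial[of k] by auto
  have "\<exists>\<alpha>. \<forall>i<k. v i = (\<Sum>a<k. \<alpha> a * b a i)" for v
  proof -
    obtain \<alpha> where "(\<lambda>i. if i < k then v i else 0) = (\<lambda>i. \<Sum>a<k. \<alpha> a * b a i)"
      using span[rule_format, of "\<lambda>i. if i < k then v i else 0"] by auto
    then have "\<forall>i<k. v i = (\<Sum>a<k. \<alpha> a * b a i)" by (metis (no_types, lifting))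
    then show ?thesis by blast
  qed
  with on show thesis using that by blast
qed

lemma orthonormal_self:
  assumes "\<And>a a'. a < k \<Longrightarrow> a' < k \<Longrightarrow> A (b a) (b a') = (if a = a' then 1 else 0)"
  shows "A (\<lambda>i. \<Sum>a<k. \<alpha> a * b a i) (\<lambda>i. \<Sum>a<k. \<alpha> a * b a i) = (\<Sum>a<k. (\<alpha> a)\<^sup>2)"
proof -
  have "(\<Sum>a'<k. \<alpha> a' * A (b a) (b a')) = \<alpha> a" if "a < k" for a
  proof -
    have "(\<Sum>a'<k. \<alpha> a' * A (b a) (b a')) = (\<Sum>a'<k. if a' = a then \<alpha> a' else 0)"
      using assms that by (intro sum.cong) auto
    then show ?thesis using that by simp
  qed
  then show ?thesis
    by (simp add: lincomb_left lincomb_right power2_eq_square)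
qed

end

section \<open>Rounding of fractional coefficients\<close>

lemma linear_dependence:
  fixes x :: "'a \<Rightarrow> nat \<Rightarrow> real"
  assumes "finite J" "k < card J"
  shows "\<exists>\<gamma>. (\<exists>j\<in>J. \<gamma> j \<noteq> 0) \<and> (\<forall>i<k. (\<Sum>j\<in>J. \<gamma> j * x j i) = 0)"
  using assms
proof (induction k arbitrary: J x)
  case 0
  then have "J \<noteq> {}" by auto
  then show ?case by (intro exI[of _ "\<lambda>_. 1"]) auto
next
  case (Suc k)
  show ?case
  proof (cases "\<forall>j\<in>J. x j k = 0")
    case True
    obtain \<gamma> where "\<exists>j\<in>J. \<gamma> j \<noteq> 0" "\<forall>i<k. (\<Sum>j\<in>J. \<gamma> j * x j i) = 0"
      using Suc.IH[of J x] Suc.prems by auto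
    then show ?thesis using True by (intro exI[of _ \<gamma>]) (auto simp: less_Suc_eq)
  next
    case False
    then obtain p where p: "p \<in> J" "x p k \<noteq> 0" by blast
    \<comment> \<open>One elimination step: the pivot \<open>p\<close> clears coordinate
      \<open>k\<close> from the other vectors, and \<mu> collects in the coefficient of
      \<open>p\<close> what was subtracted.\<close>
    define y where "y j i = x j i - x j k / x p k * x p i" for j i
    have "k < card (J - {p})" using Suc.prems p by simp
    then obtain \<gamma> where \<gamma>: "\<exists>j\<in>J-{p}. \<gamma> j \<noteq> 0" "\<forall>i<k. (\<Sum>j\<in>J-{p}. \<gamma> j * y j i) = 0"
      using Suc.IH[of "J - {p}" y] Suc.prems by auto
    define \<mu> where "\<mu> = \<gamma>(p := - (\<Sum>j\<in>J-{p}. \<gamma> j * (x j k / x p k)))"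
    have "(\<Sum>j\<in>J. \<mu> j * x j i) = (\<Sum>j\<in>J-{p}. \<gamma> j * y j i)" for i
    proof -
      have "(\<Sum>j\<in>J. \<mu> j * x j i) = \<mu> p * x p i + (\<Sum>j\<in>J-{p}. \<mu> j * x j i)"
        using Suc.prems p by (simp add: sum.remove)
      also have "(\<Sum>j\<in>J-{p}. \<mu> j * x j i) = (\<Sum>j\<in>J-{p}. \<gamma> j * x j i)"
        by (intro sum.cong) (auto simp: \<mu>_def)
      also have "\<mu> p * x p i = - (\<Sum>j\<in>J-{p}. \<gamma> j * (x j k / x p k) * x p i)"
        by (simp add: \<mu>_def sum_distrib_right)
      finally show ?thesis by (simp add: y_def algebra_simps sum_subtractf)
    qed
    moreover have "y j k = 0" for j using p by (simp add: y_def)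
    ultimately have "\<forall>i<Suc k. (\<Sum>j\<in>J. \<mu> j * x j i) = 0"
      using \<gamma>(2) by (auto simp: less_Suc_eq)
    moreover have "\<exists>j\<in>J. \<mu> j \<noteq> 0" using \<gamma>(1) by (auto simp: \<mu>_def)
    ultimately show ?thesis by blast
  qed
qed

lemma move_to_boundary:
  fixes y \<gamma> :: "'a \<Rightarrow> real"
  assumes "finite J" "\<exists>j\<in>J. \<gamma> j \<noteq> 0" "\<And>j. j \<in> J \<Longrightarrow> 0 < y j \<and> y j < 1"
  shows "\<exists>t. (\<forall>j\<in>J. 0 \<le> y j + t * \<gamma> j \<and> y j + t * \<gamma> j \<le> 1) \<and>
    (\<exists>j\<in>J. y j + t * \<gamma> j = 0 \<or> y j + t * \<gamma> j = 1)"
proof -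
  define I where "I = {j \<in> J. \<gamma> j \<noteq> 0}"
  \<comment> \<open>\<open>T j\<close> is the time at which coefficient \<open>j\<close> reaches 0
    or 1 when it moves with velocity \<open>\<gamma> j\<close>; stopping at the earliest such time
    keeps all of them in [0,1].\<close>
  define T where "T j = (if \<gamma> j > 0 then (1 - y j) / \<gamma> j else y j / (- \<gamma> j))" for j
  have I: "finite I" "I \<noteq> {}" using assms by (auto simp: I_def)
  define t where "t = Min (T ` I)"
  have "t \<in> T ` I" unfolding t_def using I by (intro Min_in) auto
  then obtain j0 where j0: "j0 \<in> I" "t = T j0" by blast
  have le: "t \<le> T j" if "j \<in> I" for j using I that by (simp add: t_def)
  have "T j > 0" if "j \<in> I" for j
    using that assms(3)[of j] by (auto simp: T_def I_def intro!: divide_pos_neg)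
  then have t0: "t > 0" using j0 by simp
  have "0 \<le> y j + t * \<gamma> j \<and> y j + t * \<gamma> j \<le> 1" if j: "j \<in> J" for j
  proof (cases "\<gamma> j" "0::real" rule: linorder_cases)
    case less
    then have "t \<le> y j / (- \<gamma> j)" using le[of j] j by (simp add: T_def I_def)
    then have "t * (- \<gamma> j) \<le> y j" using less by (metis neg_0_less_iff_less pos_le_divide_eq)
    moreover have "t * \<gamma> j \<le> 0" using less t0 by (simp add: mult_nonneg_nonpos)
    ultimately show ?thesis using assms(3)[OF j] by simp
  next
    case equal
    then show ?thesis using assms(3)[OF j] by simp
  next
    case greater
    then have "t \<le> (1 - y j) / \<gamma> j" using le[of j] j by (simp add: T_def I_def)
    then have "t * \<gamma> j \<le> 1 - y j" using greater by (simp add: pos_le_divide_eq)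
    moreover have "t * \<gamma> j \<ge> 0" using greater t0 by simp
    ultimately show ?thesis using assms(3)[OF j] by simp
  qed
  moreover have "y j0 + t * \<gamma> j0 = 0 \<or> y j0 + t * \<gamma> j0 = 1"
    using j0 by (auto simp: T_def I_def)
  ultimately show ?thesis using j0 by (intro exI[of _ t]) (auto simp: I_def)
qed

text \<open>Induction on the number of fractional coefficients. Moving along a dependence among
  their vectors makes one more of them integral and leaves the sum unchanged; this works until at
  most \<open>k\<close> are left, and dropping those costs at most \<open>c\<close> each.\<close>

lemma round_coefficients:
  fixes x :: "'a \<Rightarrow> nat \<Rightarrow> real"
  assumes "finite J" "\<And>j. j \<in> J \<Longrightarrow> 0 \<le> y j \<and> y j \<le> 1"
    and "\<And>j. j \<in> J \<Longrightarrow> l1_norm k (x j) \<le> c" "0 \<le> c"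
  shows "\<exists>K\<subseteq>J. l1_norm k (\<lambda>i. (\<Sum>j\<in>K. x j i) - (\<Sum>j\<in>J. y j * x j i)) \<le> real k * c"
  using assms(2)
proof (induction "card {j \<in> J. 0 < y j \<and> y j < 1}" arbitrary: y rule: less_induct)
  case less
  define Fr where "Fr = {j \<in> J. 0 < y j \<and> y j < 1}"
  have fin: "finite Fr" using assms(1) by (simp add: Fr_def)
  show ?case
  proof (cases "card Fr \<le> k")
    case True
    \<comment> \<open>The remaining fractional coefficients are rounded down to 0.\<close>
    define K where "K = {j \<in> J. y j = 1}"
    have "(\<Sum>j\<in>K. x j i) - (\<Sum>j\<in>J. y j * x j i) = (\<Sum>j\<in>Fr. - y j * x j i)" for i
    proof -
      have "(\<Sum>j\<in>J. y j * x j i) = (\<Sum>j\<in>K \<union> Fr. y j * x j i)"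
        using less.prems assms(1)
        by (intro sum.mono_neutral_right) (auto simp: K_def Fr_def less_le)
      also have "\<dots> = (\<Sum>j\<in>K. y j * x j i) + (\<Sum>j\<in>Fr. y j * x j i)"
        using assms(1) by (intro sum.union_disjoint) (auto simp: K_def Fr_def)
      also have "(\<Sum>j\<in>K. y j * x j i) = (\<Sum>j\<in>K. x j i)"
        by (intro sum.cong) (auto simp: K_def)
      finally show ?thesis by (simp add: sum_negf)
    qed
    then have "l1_norm k (\<lambda>i. (\<Sum>j\<in>K. x j i) - (\<Sum>j\<in>J. y j * x j i)) =
        l1_norm k (\<lambda>i. \<Sum>j\<in>Fr. - y j * x j i)" by simp
    also have "\<dots> \<le> (\<Sum>j\<in>Fr. l1_norm k (\<lambda>i. - y j * x j i))"
      by (rule l1_norm_sum)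
    also have "\<dots> \<le> (\<Sum>j\<in>Fr. c)"
    proof (rule sum_mono)
      fix j assume j: "j \<in> Fr"
      have "l1_norm k (\<lambda>i. - y j * x j i) = y j * l1_norm k (x j)"
        unfolding l1_norm_scale using j by (simp add: Fr_def)
      also have "\<dots> \<le> 1 * c"
        using j assms(3,4) by (intro mult_mono) (auto simp: Fr_def l1_norm_nonneg)
      finally show "l1_norm k (\<lambda>i. - y j * x j i) \<le> c" by simp
    qed
    also have "\<dots> \<le> real k * c"
      using True assms(4) by (simp add: mult_right_mono)
    finally show ?thesis by (intro exI[of _ K]) (auto simp: K_def)
  next
    case False
    then obtain \<gamma> where \<gamma>: "\<exists>j\<in>Fr. \<gamma> j \<noteq> 0" "\<forall>i<k. (\<Sum>j\<in>Fr. \<gamma> j * x j i) = 0"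
      using linear_dependence[OF fin, of k x] by auto
    obtain t where t: "\<forall>j\<in>Fr. 0 \<le> y j + t * \<gamma> j \<and> y j + t * \<gamma> j \<le> 1"
      "\<exists>j\<in>Fr. y j + t * \<gamma> j = 0 \<or> y j + t * \<gamma> j = 1"
      using move_to_boundary[OF fin \<gamma>(1), of y] by (auto simp: Fr_def)
    define y' where "y' j = (if j \<in> Fr then y j + t * \<gamma> j else y j)" for j
    have y': "0 \<le> y' j \<and> y' j \<le> 1" if "j \<in> J" for j
      using t(1) less.prems that by (simp add: y'_def)
    have "{j \<in> J. 0 < y' j \<and> y' j < 1} \<subseteq> Fr"
      by (auto simp: y'_def Fr_def)
    moreover obtain j1 where "j1 \<in> Fr" "y' j1 = 0 \<or> y' j1 = 1"
      using t(2) by (auto simp: y'_def)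
    ultimately have "{j \<in> J. 0 < y' j \<and> y' j < 1} \<subset> Fr"
      by (intro psubsetI) auto
    then have "card {j \<in> J. 0 < y' j \<and> y' j < 1} < card Fr"
      by (rule psubset_card_mono[OF fin])
    then obtain K where K: "K \<subseteq> J"
      "l1_norm k (\<lambda>i. (\<Sum>j\<in>K. x j i) - (\<Sum>j\<in>J. y' j * x j i)) \<le> real k * c"
      using less.hyps[of y'] y' by (auto simp: Fr_def)
    have "(\<Sum>j\<in>J. y' j * x j i) = (\<Sum>j\<in>J. y j * x j i)" if "i < k" for i
    proof -
      have "(\<Sum>j\<in>J. y' j * x j i) = (\<Sum>j\<in>J. y j * x j i + (if j \<in> Fr then t * (\<gamma> j * x j i) else 0))"
        by (intro sum.cong) (auto simp: y'_def algebra_simps)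
      also have "\<dots> = (\<Sum>j\<in>J. y j * x j i) + (\<Sum>j\<in>Fr. t * (\<gamma> j * x j i))"
        using assms(1) by (simp add: sum.distrib sum.If_cases Fr_def Int_def conj_commute)
      also have "(\<Sum>j\<in>Fr. t * (\<gamma> j * x j i)) = 0"
        using \<gamma>(2) that by (simp flip: sum_distrib_left)
      finally show ?thesis by simp
    qed
    then have "l1_norm k (\<lambda>i. (\<Sum>j\<in>K. x j i) - (\<Sum>j\<in>J. y' j * x j i)) =
        l1_norm k (\<lambda>i. (\<Sum>j\<in>K. x j i) - (\<Sum>j\<in>J. y j * x j i))"
      by (simp add: l1_norm_def)
    with K show ?thesis by auto
  qed
qed

section \<open>Least squares over a box\<close>

text \<open>For \<open>S v / 2 - dot k v e\<close> the negative gradient is the residual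
  \<open>g\<close>. At a minimum over the box, \<open>dot k w g \<le> 0\<close> for the direction
  \<open>w\<close> towards the point \<open>sgn (g i) / 8\<close>, that is,
  \<open>l1_norm k g / 8 \<le> dot k v g\<close>, and the right side is the quantity bounded by
  \<open>B\<close>. A near-minimiser avoids compactness and replaces 0 by 1, whence
  \<open>B + 1\<close>.\<close>

lemma box_least_squares:
  assumes "finite J" "\<And>j. j \<in> J \<Longrightarrow> l1_norm k (d j) \<le> 4"
    and bound: "\<And>v. (\<And>i. i < k \<Longrightarrow> \<bar>v i\<bar> \<le> 1/8) \<Longrightarrow> dot k v e - (\<Sum>j\<in>J. (dot k v (d j))\<^sup>2) \<le> B"
  obtains v where "\<And>i. i < k \<Longrightarrow> \<bar>v i\<bar> \<le> 1/8"
    "l1_norm k (\<lambda>i. e i - (\<Sum>j\<in>J. dot k v (d j) * d j i)) \<le> 8 * (B + 1)"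
proof -
  define S where "S v = (\<Sum>j\<in>J. (dot k v (d j))\<^sup>2)" for v
  define \<Phi> where "\<Phi> v = S v / 2 - dot k v e" for v
  define Box where "Box = {v :: nat \<Rightarrow> real. \<forall>i<k. \<bar>v i\<bar> \<le> 1/8}"
  \<comment> \<open>The step length tames the quadratic term: the coordinates of \<open>w\<close>
    are at most 1/4 in absolute value and each \<open>d j\<close> has norm at most 4, so
    \<open>S w\<close> is at most the cardinality of \<open>J\<close> and
    \<open>\<theta> * S w \<le> 1\<close>.\<close>
  define \<theta> :: real where "\<theta> = 1 / (real (card J) + 1)"
  have \<theta>: "0 < \<theta>" "\<theta> \<le> 1" "\<theta> * real (card J) \<le> 1"
    by (auto simp: \<theta>_def divide_le_eq)
  have bdd: "bdd_below (\<Phi> ` Box)"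
  proof (rule bdd_belowI2)
    fix v assume "v \<in> Box"
    then have "\<bar>dot k v e\<bar> \<le> 1/8 * l1_norm k e"
      by (intro abs_dot_le) (auto simp: Box_def)
    moreover have "S v \<ge> 0" by (simp add: S_def sum_nonneg)
    ultimately show "- (1/8 * l1_norm k e) \<le> \<Phi> v" by (simp add: \<Phi>_def)
  qed
  have "(\<lambda>_. 0) \<in> Box" by (simp add: Box_def)
  then have ne: "\<Phi> ` Box \<noteq> {}" by blast
  have "\<exists>x\<in>\<Phi> ` Box. x < Inf (\<Phi> ` Box) + \<theta> / 2"
    using cInf_less_iff[OF ne bdd, of "Inf (\<Phi> ` Box) + \<theta> / 2"] \<theta> by simp
  then obtain v where v: "v \<in> Box" "\<Phi> v < Inf (\<Phi> ` Box) + \<theta> / 2" by blast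
  define g where "g i = e i - (\<Sum>j\<in>J. dot k v (d j) * d j i)" for i
  define w where "w i = sgn (g i) / 8 - v i" for i
  define v' where "v' = (\<lambda>i. v i + \<theta> * w i)"
  have "\<bar>v' i\<bar> \<le> 1/8" if "i < k" for i
  proof -
    have "v' i = (1 - \<theta>) * v i + \<theta> * (sgn (g i) / 8)"
      by (simp add: v'_def w_def algebra_simps)
    then have "\<bar>v' i\<bar> \<le> \<bar>(1 - \<theta>) * v i\<bar> + \<bar>\<theta> * (sgn (g i) / 8)\<bar>"
      by (metis abs_triangle_ineq)
    also have "\<dots> = (1 - \<theta>) * \<bar>v i\<bar> + \<theta> * \<bar>sgn (g i) / 8\<bar>"
      using \<theta> by (simp add: abs_mult)
    also have "\<dots> \<le> (1 - \<theta>) * (1/8) + \<theta> * (1/8)"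
      using \<theta> v(1) that by (intro add_mono mult_left_mono) (auto simp: Box_def sgn_if)
    also have "\<dots> = 1/8" by (simp add: field_simps)
    finally show ?thesis .
  qed
  then have "v' \<in> Box" by (simp add: Box_def)
  then have "Inf (\<Phi> ` Box) \<le> \<Phi> v'" using bdd by (intro cInf_lower) auto
  then have min: "\<Phi> v - \<Phi> v' \<le> \<theta> / 2" using v(2) by linarith
  have gdot: "dot k u g = dot k u e - (\<Sum>j\<in>J. dot k v (d j) * dot k u (d j))" for u
    unfolding g_def dot_diff_right by (simp add: dot_sum_right dot_scale_right)
  have S': "S v' = S v + 2 * \<theta> * (\<Sum>j\<in>J. dot k v (d j) * dot k w (d j)) + \<theta>\<^sup>2 * S w"
    unfolding S_def v'_def dot_add_left dot_scale_left
    by (simp add: sum_distrib_left sum.distrib[symmetric] power2_eq_square algebra_simps)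
  have "S w \<le> (\<Sum>j\<in>J. 1)"
    unfolding S_def
  proof (rule sum_mono)
    fix j assume j: "j \<in> J"
    have "\<bar>w i\<bar> \<le> 1/4" if "i < k" for i
    proof -
      have "\<bar>v i\<bar> \<le> 1/8" using v(1) that by (simp add: Box_def)
      then show ?thesis by (auto simp: w_def sgn_if abs_le_iff)
    qed
    then have "\<bar>dot k w (d j)\<bar> \<le> 1/4 * l1_norm k (d j)" by (rule abs_dot_le)
    also have "\<dots> \<le> 1" using assms(2)[OF j] by simp
    finally show "(dot k w (d j))\<^sup>2 \<le> 1" by (simp add: abs_square_le_1)
  qed
  then have Sw: "S w \<le> real (card J)" by simp
  have "\<Phi> v - \<Phi> v' = \<theta> * dot k w g - \<theta>\<^sup>2 * S w / 2"
    unfolding \<Phi>_def S' gdot by (simp add: v'_def dot_add_left dot_scale_left algebra_simps)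
  with min have "\<theta> * dot k w g \<le> \<theta> / 2 + \<theta>\<^sup>2 * S w / 2" by linarith
  also have "\<theta>\<^sup>2 * S w = \<theta> * (\<theta> * S w)" by (simp add: power2_eq_square)
  also have "\<dots> \<le> \<theta> * 1"
  proof (intro mult_left_mono)
    have "\<theta> * S w \<le> \<theta> * real (card J)" using Sw \<theta> by (intro mult_left_mono) auto
    then show "\<theta> * S w \<le> 1" using \<theta>(3) by linarith
  qed (use \<theta> in auto)
  finally have "\<theta> * dot k w g \<le> \<theta> * 1" by simp
  then have wg: "dot k w g \<le> 1" using \<theta>(1) by (simp only: mult_le_cancel_left_pos)
  have "l1_norm k g = (\<Sum>i<k. sgn (g i) * g i)"
    by (simp add: l1_norm_def abs_sgn mult.commute)
  then have "l1_norm k g / 8 = dot k (\<lambda>i. sgn (g i) / 8) g"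
    by (simp add: dot_def sum_divide_distrib)
  also have "\<dots> = dot k w g + dot k v g"
    by (simp add: w_def flip: dot_add_left)
  also have "dot k v g = dot k v e - S v"
    by (simp add: gdot S_def power2_eq_square)
  also have "\<dots> \<le> B"
    unfolding S_def using v(1) by (intro bound) (auto simp: Box_def)
  finally have "l1_norm k g \<le> 8 * (B + 1)" using wg by simp
  then show thesis using that[of v] v(1) by (simp add: Box_def g_def[abs_def])
qed

text \<open>Radius 1/8 against norm 4 is exactly what keeps the coefficients 1/2 +
  \<open>dot k v (d j)\<close> in [0,1]; the centre 1/2 is the reason for half of the total in the
  target. Rounding contributes the summand \<open>4 * real k\<close>.\<close>

lemma subset_sum_approx:
  assumes "finite J" "\<And>j. j \<in> J \<Longrightarrow> l1_norm k (d j) \<le> 4"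
    and "\<And>v. (\<And>i. i < k \<Longrightarrow> \<bar>v i\<bar> \<le> 1/8) \<Longrightarrow> dot k v e - (\<Sum>j\<in>J. (dot k v (d j))\<^sup>2) \<le> B"
  shows "\<exists>K\<subseteq>J. l1_norm k (\<lambda>i. (\<Sum>j\<in>K. d j i) - (e i + (\<Sum>j\<in>J. d j i) / 2)) \<le> 8 * (B + 1) + 4 * real k"
proof -
  obtain v where v: "\<And>i. i < k \<Longrightarrow> \<bar>v i\<bar> \<le> 1/8"
    "l1_norm k (\<lambda>i. e i - (\<Sum>j\<in>J. dot k v (d j) * d j i)) \<le> 8 * (B + 1)"
    using box_least_squares[OF assms] by blast
  define y where "y j = 1/2 + dot k v (d j)" for j
  have "0 \<le> y j \<and> y j \<le> 1" if "j \<in> J" for j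
  proof -
    have "\<bar>dot k v (d j)\<bar> \<le> 1/8 * l1_norm k (d j)" using v(1) by (rule abs_dot_le)
    also have "\<dots> \<le> 1/2" using assms(2)[OF that] by simp
    finally show ?thesis unfolding y_def by linarith
  qed
  then obtain K where K: "K \<subseteq> J"
    "l1_norm k (\<lambda>i. (\<Sum>j\<in>K. d j i) - (\<Sum>j\<in>J. y j * d j i)) \<le> real k * 4"
    using round_coefficients[of J y k d 4] assms(1,2) by auto
  have eq: "(\<Sum>j\<in>K. d j i) - (e i + (\<Sum>j\<in>J. d j i) / 2) =
      ((\<Sum>j\<in>K. d j i) - (\<Sum>j\<in>J. y j * d j i)) - (e i - (\<Sum>j\<in>J. dot k v (d j) * d j i))" for i
    by (simp add: y_def algebra_simps sum.distrib sum_divide_distrib)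
  have "l1_norm k (\<lambda>i. (\<Sum>j\<in>K. d j i) - (e i + (\<Sum>j\<in>J. d j i) / 2)) \<le>
      l1_norm k (\<lambda>i. (\<Sum>j\<in>K. d j i) - (\<Sum>j\<in>J. y j * d j i)) +
      l1_norm k (\<lambda>i. e i - (\<Sum>j\<in>J. dot k v (d j) * d j i))"
    unfolding eq by (rule l1_norm_triangle_diff)
  with K v(2) show ?thesis by (intro exI[of _ K]) auto
qed

section \<open>Uniform concentration of a random quadratic form\<close>

lemma sum_square_lincomb:
  fixes x :: "nat \<Rightarrow> 'a \<Rightarrow> real"
  shows "(\<Sum>j\<in>J. (\<Sum>a<k. \<alpha> a * x a j)\<^sup>2) =
    (\<Sum>p\<in>{..<k} \<times> {..<k}. \<alpha> (fst p) * \<alpha> (snd p) * (\<Sum>j\<in>J. x (fst p) j * x (snd p) j))"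
proof -
  have "(\<Sum>j\<in>J. (\<Sum>a<k. \<alpha> a * x a j)\<^sup>2) =
      (\<Sum>j\<in>J. \<Sum>p\<in>{..<k} \<times> {..<k}. \<alpha> (fst p) * \<alpha> (snd p) * (x (fst p) j * x (snd p) j))"
    by (simp add: power2_eq_square sum_product sum.cartesian_product case_prod_beta algebra_simps)
  then show ?thesis by (simp add: sum.swap[of _ J] sum_distrib_left)
qed

text \<open>The operator norm of a matrix is at most its Hilbert-Schmidt norm, here 1/2. Double sums
  are taken over a product set so that Cauchy-Schwarz applies to them directly.\<close>

lemma abs_double_sum_le:
  fixes \<Delta> :: "nat \<times> nat \<Rightarrow> real"
  assumes "(\<Sum>p\<in>{..<k} \<times> {..<k}. (\<Delta> p)\<^sup>2) \<le> 1/4"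
  shows "\<bar>\<Sum>p\<in>{..<k} \<times> {..<k}. \<alpha> (fst p) * \<alpha> (snd p) * \<Delta> p\<bar> \<le> (\<Sum>a<k. (\<alpha> a)\<^sup>2) / 2"
proof -
  define n where "n = (\<Sum>a<k. (\<alpha> a)\<^sup>2)"
  have n: "n \<ge> 0" by (simp add: n_def sum_nonneg)
  have "(\<Sum>p\<in>{..<k} \<times> {..<k}. (\<alpha> (fst p) * \<alpha> (snd p))\<^sup>2) = n\<^sup>2"
    by (simp add: n_def power2_eq_square sum_product sum.cartesian_product case_prod_beta algebra_simps)
  then have "(\<Sum>p\<in>{..<k} \<times> {..<k}. \<alpha> (fst p) * \<alpha> (snd p) * \<Delta> p)\<^sup>2 \<le>
      n\<^sup>2 * (\<Sum>p\<in>{..<k} \<times> {..<k}. (\<Delta> p)\<^sup>2)"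
    using Cauchy_Schwarz_ineq_sum[of "\<lambda>p. \<alpha> (fst p) * \<alpha> (snd p)" \<Delta> "{..<k} \<times> {..<k}"] by simp
  also have "\<dots> \<le> n\<^sup>2 * (1/4)" using assms by (intro mult_left_mono) auto
  also have "\<dots> = (n / 2)\<^sup>2" by (simp add: power2_eq_square)
  finally have "(\<Sum>p\<in>{..<k} \<times> {..<k}. \<alpha> (fst p) * \<alpha> (snd p) * \<Delta> p)\<^sup>2 \<le> (n / 2)\<^sup>2" .
  then have "\<bar>\<Sum>p\<in>{..<k} \<times> {..<k}. \<alpha> (fst p) * \<alpha> (snd p) * \<Delta> p\<bar> \<le> \<bar>n / 2\<bar>"
    by (simp only: abs_le_square_iff)
  then show ?thesis using n by (simp add: n_def)
qed

text \<open>
  The random Gram form \<open>\<Sum>j<m. (v \<bullet> d \<pi> j)\<^sup>2\<close> is compared with its mean \<open>Q\<close>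
  uniformly in \<open>v\<close>, by the Hilbert-Schmidt norm of the difference in a basis that is orthonormal
  for the regularised form \<open>A = Q + c k I\<close>. In this basis the traces of \<open>Q\<close> and of the covariance
  of \<open>err\<close> are \<open>O(k)\<close>.
\<close>

lemma uniform_form_bound:
  fixes err :: "(nat \<Rightarrow> nat) \<Rightarrow> nat \<Rightarrow> real" and d :: "(nat \<Rightarrow> nat) \<Rightarrow> nat \<Rightarrow> nat \<Rightarrow> real"
  assumes "0 < R" "1 \<le> k"
    and norm: "\<And>\<pi> j. \<pi> permutes {..<N} \<Longrightarrow> j < m \<Longrightarrow> l1_norm k (d \<pi> j) \<le> 4"
    and err: "\<And>u. perm_avg N (\<lambda>\<pi>. (dot k u (err \<pi>))\<^sup>2) \<le>
        30 * R * (\<Sum>j<m. perm_avg N (\<lambda>\<pi>. (dot k u (d \<pi> j))\<^sup>2))"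
    and var: "\<And>u v. perm_avg N (\<lambda>\<pi>. ((\<Sum>j<m. dot k u (d \<pi> j) * dot k v (d \<pi> j)) -
          perm_avg N (\<lambda>\<pi>. \<Sum>j<m. dot k u (d \<pi> j) * dot k v (d \<pi> j)))\<^sup>2) \<le>
        48 * R * (\<Sum>j<m. perm_avg N (\<lambda>\<pi>. (dot k u (d \<pi> j))\<^sup>2 * (dot k v (d \<pi> j))\<^sup>2))"
  obtains \<pi> where "\<pi> permutes {..<N}"
    "\<And>v. dot k v (err \<pi>) - (\<Sum>j<m. (dot k v (d \<pi> j))\<^sup>2) \<le> 45 * R * k + 9216 * R * k * dot k v v"
proof -
  \<comment> \<open>9216 = 48 * 16 * 12, chosen to bring the mean of \<open>Z2\<close> down to
    1/12.\<close>
  define c where "c = 9216 * R"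
  have c: "c > 0" "c * real k > 0" using assms(1,2) by (simp_all add: c_def)
  define S where "S \<pi> u v = (\<Sum>j<m. dot k u (d \<pi> j) * dot k v (d \<pi> j))" for \<pi> u v
  define Q where "Q u v = perm_avg N (\<lambda>\<pi>. S \<pi> u v)" for u v
  define A where "A u v = Q u v + c * k * dot k u v" for u v
  have Q_self: "Q u u = (\<Sum>j<m. perm_avg N (\<lambda>\<pi>. (dot k u (d \<pi> j))\<^sup>2))" for u
    by (simp add: Q_def S_def perm_avg_sum power2_eq_square)
  have Q_nonneg: "Q u u \<ge> 0" for u
    unfolding Q_self by (intro sum_nonneg perm_avg_nonneg) auto
  interpret pos_def_form k A
  proof
    fix u v w x
    have "S \<pi> (\<lambda>i. u i + x * v i) w = S \<pi> u w + x * S \<pi> v w" for \<pi>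
      by (simp add: S_def dot_add_left dot_scale_left sum_distrib_left sum.distrib algebra_simps)
    then show "A (\<lambda>i. u i + x * v i) w = A u w + x * A v w"
      by (simp add: A_def Q_def perm_avg_add perm_avg_cmult dot_add_left dot_scale_left algebra_simps)
  next
    fix u v show "A u v = A v u"
      by (simp add: A_def Q_def S_def dot_commute[of k u v] mult.commute)
  next
    fix u :: "nat \<Rightarrow> real" assume "\<exists>i<k. u i \<noteq> 0"
    then have "dot k u u > 0"
      unfolding dot_def by (auto intro!: sum_pos2 simp: zero_less_mult_iff neq_iff)
    then have "c * k * dot k u u > 0" using c by simp
    then show "0 < A u u" using Q_nonneg[of u] by (simp add: A_def)
  qed
  obtain b where on: "\<And>a a'. a < k \<Longrightarrow> a' < k \<Longrightarrow> A (b a) (b a') = (if a = a' then 1 else 0)"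
    and span: "\<And>v. \<exists>\<alpha>. \<forall>i<k. v i = (\<Sum>a<k. \<alpha> a * b a i)"
    using orthonormal_basis_obtains by blast
  have Q_basis: "Q (b a) (b a) \<le> 1" if "a < k" for a
    using on[OF that that] mult_nonneg_nonneg[OF less_imp_le[OF c(2)] dot_self_nonneg[of k "b a"]]
    by (simp add: A_def)
  have dot_lincomb: "dot k (\<lambda>i. \<Sum>a<k. \<alpha> a * b a i) x = (\<Sum>a<k. \<alpha> a * dot k (b a) x)" for \<alpha> x
    unfolding dot_sum_left dot_scale_left ..
  \<comment> \<open>The squared norm of \<open>d \<pi> j\<close> in the norm dual to
    \<open>A\<close>.\<close>
  define s where "s \<pi> j = (\<Sum>a<k. (dot k (b a) (d \<pi> j))\<^sup>2)" for \<pi> j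
  have s_nonneg: "s \<pi> j \<ge> 0" for \<pi> j by (simp add: s_def sum_nonneg)
  have s_le: "s \<pi> j \<le> 16 / (c * k)" if "\<pi> permutes {..<N}" "j < m" for \<pi> j
  proof (cases "s \<pi> j = 0")
    case False
    define x where "x = d \<pi> j"
    \<comment> \<open>The Riesz representative of the functional given by \<open>x\<close>, with
      respect to \<open>A\<close>: both \<open>A v v\<close> and \<open>dot k v x\<close> equal
      \<open>s \<pi> j\<close>. As \<open>A\<close> dominates \<open>c * k\<close> times the dot
      product, Cauchy-Schwarz yields the bound.\<close>
    define v where "v = (\<lambda>i. \<Sum>a<k. dot k (b a) x * b a i)"
    have "A v v = s \<pi> j" unfolding v_def s_def x_def by (rule orthonormal_self[OF on])
    then have 1: "c * k * dot k v v \<le> s \<pi> j" using Q_nonneg[of v] by (simp add: A_def)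
    have "dot k x x \<le> (l1_norm k x)\<^sup>2" by (rule dot_self_le_l1_norm)
    also have "\<dots> \<le> 4\<^sup>2" unfolding x_def by (intro power_mono norm that l1_norm_nonneg)
    finally have 2: "dot k x x \<le> 16" by simp
    have "dot k v x = s \<pi> j"
      by (simp add: v_def dot_lincomb s_def x_def power2_eq_square)
    then have "(s \<pi> j)\<^sup>2 \<le> dot k v v * dot k x x" using dot_cauchy_schwarz[of k v x] by simp
    also have "\<dots> \<le> dot k v v * 16" using 2 dot_self_nonneg by (intro mult_left_mono)
    finally have "c * k * (s \<pi> j)\<^sup>2 \<le> c * k * (dot k v v * 16)"
      using c by (intro mult_left_mono) auto
    also have "\<dots> \<le> s \<pi> j * 16" using 1 by simp
    finally have "s \<pi> j * (c * k * s \<pi> j) \<le> s \<pi> j * 16" by (simp add: power2_eq_square algebra_simps)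
    then have "c * k * s \<pi> j \<le> 16"
      using False s_nonneg[of \<pi> j] by (metis less_eq_real_def mult_le_cancel_left_pos)
    then show ?thesis using c by (simp add: pos_le_divide_eq mult.commute)
  next
    case True
    have "0 \<le> 16 / (c * k)" using c(2) by (intro divide_nonneg_pos) auto
    then show ?thesis using True by simp
  qed
  \<comment> \<open>\<open>Z1\<close> is the squared dual norm of the error, \<open>Z2\<close> the
    squared Hilbert-Schmidt norm of the deviation of the Gram form from its mean.\<close>
  define Z1 where "Z1 \<pi> = (\<Sum>a<k. (dot k (b a) (err \<pi>))\<^sup>2)" for \<pi>
  define \<Delta> where "\<Delta> \<pi> p = S \<pi> (b (fst p)) (b (snd p)) - Q (b (fst p)) (b (snd p))" for \<pi> p
  define Z2 where "Z2 \<pi> = (\<Sum>p\<in>{..<k} \<times> {..<k}. (\<Delta> \<pi> p)\<^sup>2)" for \<pi>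
  have "perm_avg N Z1 = (\<Sum>a<k. perm_avg N (\<lambda>\<pi>. (dot k (b a) (err \<pi>))\<^sup>2))"
    unfolding Z1_def[abs_def] by (rule perm_avg_sum)
  also have "\<dots> \<le> (\<Sum>a<k. 30 * R * 1)"
  proof (rule sum_mono)
    fix a assume "a \<in> {..<k}"
    then have "30 * R * Q (b a) (b a) \<le> 30 * R * 1"
      using Q_basis assms(1) by (intro mult_left_mono) auto
    then show "perm_avg N (\<lambda>\<pi>. (dot k (b a) (err \<pi>))\<^sup>2) \<le> 30 * R * 1"
      using err[of "b a"] unfolding Q_self by linarith
  qed
  finally have Z1: "perm_avg N Z1 \<le> 30 * R * k" by (simp add: algebra_simps)
  have "perm_avg N Z2 = (\<Sum>p\<in>{..<k} \<times> {..<k}. perm_avg N (\<lambda>\<pi>. (\<Delta> \<pi> p)\<^sup>2))"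
    unfolding Z2_def[abs_def] by (rule perm_avg_sum)
  also have "\<dots> \<le> (\<Sum>p\<in>{..<k} \<times> {..<k}. 48 * R * (\<Sum>j<m. perm_avg N (\<lambda>\<pi>.
      (dot k (b (fst p)) (d \<pi> j))\<^sup>2 * (dot k (b (snd p)) (d \<pi> j))\<^sup>2)))"
    unfolding \<Delta>_def S_def Q_def by (intro sum_mono var)
  also have "\<dots> = 48 * R * (\<Sum>j<m. perm_avg N (\<lambda>\<pi>. \<Sum>p\<in>{..<k} \<times> {..<k}.
      (dot k (b (fst p)) (d \<pi> j))\<^sup>2 * (dot k (b (snd p)) (d \<pi> j))\<^sup>2))"
    by (simp add: perm_avg_sum sum.swap[of _ "{..<m}"] flip: sum_distrib_left)
  \<comment> \<open>Summed over pairs of basis vectors, the fourth moments become squares of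
    \<open>s\<close>. One factor is bounded pointwise by 16 / (c k); the means of the other add up
    to the trace of \<open>Q\<close>, which is at most \<open>k\<close>.\<close>
  also have "\<dots> = 48 * R * (\<Sum>j<m. perm_avg N (\<lambda>\<pi>. s \<pi> j * s \<pi> j))"
    by (simp add: s_def sum_product sum.cartesian_product case_prod_beta)
  also have "\<dots> \<le> 48 * R * (\<Sum>j<m. perm_avg N (\<lambda>\<pi>. 16 / (c * k) * s \<pi> j))"
    using assms(1) s_le s_nonneg by (intro mult_left_mono sum_mono perm_avg_mono mult_right_mono) auto
  also have "\<dots> = 48 * R * (16 / (c * k)) * (\<Sum>j<m. perm_avg N (\<lambda>\<pi>. s \<pi> j))"
    unfolding perm_avg_cmult sum_distrib_left[symmetric] by simp
  also have "(\<Sum>j<m. perm_avg N (\<lambda>\<pi>. s \<pi> j)) = (\<Sum>a<k. Q (b a) (b a))"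
    unfolding s_def Q_self perm_avg_sum by (rule sum.swap)
  also have "48 * R * (16 / (c * k)) * (\<Sum>a<k. Q (b a) (b a)) \<le> 48 * R * (16 / (c * k)) * (\<Sum>a<k. 1)"
    using Q_basis c assms(1) by (intro mult_left_mono sum_mono) auto
  also have "\<dots> = 1/12" using assms(1,2) by (simp add: c_def)
  finally have Z2: "perm_avg N Z2 \<le> 1/12" .
  \<comment> \<open>Two Markov bounds in one: the weights bring each mean down to 1/3, and a value
    below 1 gives \<open>Z1 \<pi> \<le> 90 * R * k\<close> and \<open>Z2 \<pi> \<le> 1/4\<close> for
    the same permutation.\<close>
  have "perm_avg N (\<lambda>\<pi>. 1 / (90 * R * k) * Z1 \<pi> + 4 * Z2 \<pi>) =
      1 / (90 * R * k) * perm_avg N Z1 + 4 * perm_avg N Z2"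
    by (simp only: perm_avg_add perm_avg_cmult)
  also have "\<dots> \<le> 1 / (90 * R * k) * (30 * R * k) + 4 * (1/12)"
    using Z1 Z2 assms(1) by (intro add_mono mult_left_mono) auto
  also have "\<dots> < 1" using assms(1,2) by simp
  finally obtain \<pi> where \<pi>: "\<pi> permutes {..<N}" "1 / (90 * R * k) * Z1 \<pi> + 4 * Z2 \<pi> < 1"
    by (rule perm_avg_less_obtains)
  have nonneg: "0 \<le> 1 / (90 * R * k) * Z1 \<pi>" "0 \<le> Z2 \<pi>"
    using assms(1) by (auto simp: Z1_def Z2_def intro!: sum_nonneg divide_nonneg_nonneg)
  have Z2\<pi>: "Z2 \<pi> \<le> 1/4" using \<pi>(2) nonneg by linarith
  have "1 / (90 * R * k) * Z1 \<pi> \<le> 1" using \<pi>(2) nonneg by linarith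
  then have Z1\<pi>: "Z1 \<pi> \<le> 90 * R * k" using assms(1,2) by (simp add: divide_le_eq)
  have "dot k v (err \<pi>) - (\<Sum>j<m. (dot k v (d \<pi> j))\<^sup>2) \<le> 45 * R * k + 9216 * R * k * dot k v v" for v
  proof -
    obtain \<alpha> where \<alpha>: "\<forall>i<k. v i = (\<Sum>a<k. \<alpha> a * b a i)" using span by blast
    define w where "w = (\<lambda>i. \<Sum>a<k. \<alpha> a * b a i)"
    have dot_v: "dot k v x = (\<Sum>a<k. \<alpha> a * dot k (b a) x)" for x
      using \<alpha> by (subst dot_cong[where u' = w and v' = x]) (auto simp: w_def dot_lincomb)
    define n where "n = (\<Sum>a<k. (\<alpha> a)\<^sup>2)"
    have "A w w = n" unfolding w_def n_def by (rule orthonormal_self[OF on])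
    moreover have "dot k w w = dot k v v"
      using \<alpha> by (intro dot_cong) (auto simp: w_def)
    ultimately have Qw: "Q w w = n - c * k * dot k v v" by (simp add: A_def)
    have S_expand: "S \<pi>' w w = (\<Sum>p\<in>{..<k} \<times> {..<k}. \<alpha> (fst p) * \<alpha> (snd p) * S \<pi>' (b (fst p)) (b (snd p)))" for \<pi>'
      unfolding S_def w_def dot_lincomb
      using sum_square_lincomb[where J = "{..<m}" and k = k and \<alpha> = \<alpha>
          and x = "\<lambda>a j. dot k (b a) (d \<pi>' j)"]
      by (simp add: power2_eq_square)
    have "Q w w = (\<Sum>p\<in>{..<k} \<times> {..<k}. \<alpha> (fst p) * \<alpha> (snd p) * Q (b (fst p)) (b (snd p)))"
      unfolding Q_def S_expand perm_avg_sum perm_avg_cmult ..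
    then have "S \<pi> w w - Q w w = (\<Sum>p\<in>{..<k} \<times> {..<k}. \<alpha> (fst p) * \<alpha> (snd p) * \<Delta> \<pi> p)"
      unfolding S_expand by (simp add: \<Delta>_def algebra_simps sum_subtractf)
    then have "S \<pi> w w - Q w w \<ge> - (n / 2)"
      using abs_double_sum_le[where k = k and \<Delta> = "\<Delta> \<pi>" and \<alpha> = \<alpha>] Z2\<pi> by (simp add: Z2_def n_def)
    moreover have "S \<pi> w w = (\<Sum>j<m. (dot k v (d \<pi> j))\<^sup>2)"
      by (simp add: S_def w_def dot_v dot_lincomb power2_eq_square)
    \<comment> \<open>\<open>Q w w\<close> supplies \<open>n\<close> up to the regularisation. One
      half of it pays for the deviation of the form, the other half for this term.\<close>
    moreover have "dot k v (err \<pi>) \<le> n / 2 + Z1 \<pi> / 2"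
    proof -
      have "\<alpha> a * dot k (b a) (err \<pi>) \<le> (\<alpha> a)\<^sup>2 / 2 + (dot k (b a) (err \<pi>))\<^sup>2 / 2" for a
        using sum_squares_bound[of "\<alpha> a" "dot k (b a) (err \<pi>)"] by simp
      then have "dot k v (err \<pi>) \<le> (\<Sum>a<k. (\<alpha> a)\<^sup>2 / 2 + (dot k (b a) (err \<pi>))\<^sup>2 / 2)"
        unfolding dot_v by (intro sum_mono)
      then show ?thesis by (simp add: n_def Z1_def sum.distrib sum_divide_distrib)
    qed
    ultimately show ?thesis using Qw Z1\<pi> by (simp add: c_def)
  qed
  with \<pi>(1) show thesis using that by blast
qed

section \<open>Variance of sums over disjoint blocks of positions\<close>

text \<open>A transposition meets at most two blocks and so changes at most two summands; the
  spectral gap does the rest. The factor 16 consists of a 2 from Cauchy-Schwarz, a 2 from squaring a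
  difference, a 2 for the blocks, and a 2 for the values before and after.\<close>

lemma perm_avg_block_variance:
  assumes "0 < l" "m * l \<le> N"
    and local: "\<And>x y. (\<And>t. t < l \<Longrightarrow> x t = y t) \<Longrightarrow> g x = g y"
  defines "T \<equiv> \<lambda>\<pi>. \<Sum>b<m. g (\<lambda>t. \<pi> (b * l + t))"
  shows "perm_avg N (\<lambda>\<pi>. (T \<pi> - perm_avg N T)\<^sup>2) \<le> 16 * real N * perm_avg N (\<lambda>\<pi>. (g \<pi>)\<^sup>2)"
proof -
  define G where "G = perm_avg N (\<lambda>\<pi>. (g \<pi>)\<^sup>2)"
  have G_nonneg: "G \<ge> 0" unfolding G_def by (intro perm_avg_nonneg) auto
  have block: "perm_avg N (\<lambda>\<pi>. (g (\<lambda>t. \<pi> (b * l + t)))\<^sup>2) = G" if "b < m" for b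
  proof -
    have "(b + 1) * l \<le> m * l" using that by (intro mult_right_mono) auto
    then have le: "b * l + l \<le> N" using assms(2) by simp
    have "perm_avg N (\<lambda>\<pi>. (\<lambda>x. (g x)\<^sup>2) (\<pi> \<circ> (\<lambda>t. b * l + t))) = perm_avg N (\<lambda>\<pi>. (\<lambda>x. (g x)\<^sup>2) (\<pi> \<circ> (\<lambda>t. t)))"
    proof (rule perm_avg_injection_cong[where A = "{..<l}"])
      show "(\<lambda>t. b * l + t) ` {..<l} \<subseteq> {..<N}" using le by auto
      show "(\<lambda>t. t) ` {..<l} \<subseteq> {..<N}" using le by auto
      show "(g x)\<^sup>2 = (g y)\<^sup>2" if "\<And>t. t \<in> {..<l} \<Longrightarrow> x t = y t" for x y
        using local[of x y] that by simp
    qed (auto simp: inj_on_def)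
    then show ?thesis by (simp add: G_def o_def)
  qed
  have energy: "perm_avg N (\<lambda>\<pi>. (T \<pi> - T (\<pi> \<circ> transpose i j))\<^sup>2) \<le> 16 * G" if ij: "i < j" "j < N" for i j
  proof -
    define \<tau> where "\<tau> = transpose i j"
    have \<tau>: "\<tau> permutes {..<N}" unfolding \<tau>_def using ij by (intro permutes_swap_id) auto
    define gb where "gb b \<pi> = g (\<lambda>t. \<pi> (b * l + t))" for b \<pi>
    \<comment> \<open>Positions from \<open>m * l\<close> on lie in no block, hence the
      intersection.\<close>
    define I where "I = {i div l, j div l} \<inter> {..<m}"
    have fin: "finite I" and "card I \<le> card {i div l, j div l}"
      unfolding I_def by (auto intro: card_mono)
    moreover have "card {i div l, j div l} \<le> 2"
      by (simp add: card_insert_if)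
    ultimately have cI: "card I \<le> 2" by linarith
    have unchanged: "gb b (\<pi> \<circ> \<tau>) = gb b \<pi>" if "b \<in> {..<m} - I" for b \<pi>
      unfolding gb_def
    proof (rule local)
      fix t assume "t < l"
      then have "(b * l + t) div l = b" by simp
      then have "b * l + t \<noteq> i" "b * l + t \<noteq> j" using that by (auto simp: I_def)
      then show "(\<pi> \<circ> \<tau>) (b * l + t) = \<pi> (b * l + t)" by (simp add: \<tau>_def)
    qed
    have "(T \<pi> - T (\<pi> \<circ> \<tau>))\<^sup>2 \<le> 4 * (\<Sum>b\<in>I. (gb b \<pi>)\<^sup>2 + (gb b (\<pi> \<circ> \<tau>))\<^sup>2)" for \<pi>
    proof -
      have "T \<pi> - T (\<pi> \<circ> \<tau>) = (\<Sum>b<m. gb b \<pi> - gb b (\<pi> \<circ> \<tau>))"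
        by (simp add: T_def gb_def sum_subtractf)
      also have "\<dots> = (\<Sum>b\<in>I. gb b \<pi> - gb b (\<pi> \<circ> \<tau>))"
      proof (intro sum.mono_neutral_right ballI)
        show "gb b \<pi> - gb b (\<pi> \<circ> \<tau>) = 0" if "b \<in> {..<m} - I" for b
          using unchanged[OF that, of \<pi>] by simp
      qed (auto simp: I_def)
      finally have "(T \<pi> - T (\<pi> \<circ> \<tau>))\<^sup>2 \<le> (\<Sum>b\<in>I. (gb b \<pi> - gb b (\<pi> \<circ> \<tau>))\<^sup>2) * real (card I)"
        using sum_squared_le_sum_of_squares[where I = I and f = "\<lambda>b. gb b \<pi> - gb b (\<pi> \<circ> \<tau>)"] by simp
      also have "\<dots> \<le> (\<Sum>b\<in>I. 2 * ((gb b \<pi>)\<^sup>2 + (gb b (\<pi> \<circ> \<tau>))\<^sup>2)) * 2"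
      proof (intro mult_mono sum_mono)
        fix b
        show "(gb b \<pi> - gb b (\<pi> \<circ> \<tau>))\<^sup>2 \<le> 2 * ((gb b \<pi>)\<^sup>2 + (gb b (\<pi> \<circ> \<tau>))\<^sup>2)"
          using zero_le_power2[of "gb b \<pi> + gb b (\<pi> \<circ> \<tau>)"]
          by (simp add: power2_sum power2_diff)
      qed (use cI in \<open>auto intro!: sum_nonneg\<close>)
      finally show ?thesis by (simp add: sum_distrib_left sum_distrib_right mult.commute)
    qed
    then have "perm_avg N (\<lambda>\<pi>. (T \<pi> - T (\<pi> \<circ> \<tau>))\<^sup>2) \<le>
        perm_avg N (\<lambda>\<pi>. 4 * (\<Sum>b\<in>I. (gb b \<pi>)\<^sup>2 + (gb b (\<pi> \<circ> \<tau>))\<^sup>2))"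
      by (intro perm_avg_mono)
    also have "\<dots> = 4 * (\<Sum>b\<in>I. perm_avg N (\<lambda>\<pi>. (gb b \<pi>)\<^sup>2) + perm_avg N (\<lambda>\<pi>. (gb b (\<pi> \<circ> \<tau>))\<^sup>2))"
      by (simp only: perm_avg_cmult perm_avg_sum perm_avg_add)
    also have "\<dots> = 4 * (\<Sum>b\<in>I. G + G)"
    proof -
      have "perm_avg N (\<lambda>\<pi>. (gb b (\<pi> \<circ> \<tau>))\<^sup>2) = perm_avg N (\<lambda>\<pi>. (gb b \<pi>)\<^sup>2)" for b
        by (rule perm_avg_compose_right[OF \<tau>, of "\<lambda>\<pi>. (gb b \<pi>)\<^sup>2"])
      moreover have "perm_avg N (\<lambda>\<pi>. (gb b \<pi>)\<^sup>2) = G" if "b \<in> I" for b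
        unfolding gb_def using that by (intro block) (simp add: I_def)
      ultimately show ?thesis by simp
    qed
    also have "\<dots> = 8 * real (card I) * G" by simp
    also have "\<dots> \<le> 16 * G" using cI G_nonneg by (intro mult_right_mono) auto
    finally show ?thesis by (simp add: \<tau>_def)
  qed
  have "perm_avg N (\<lambda>\<pi>. (T \<pi> - perm_avg N T)\<^sup>2) \<le> real N * (16 * G)"
    using energy G_nonneg by (intro perm_avg_variance_le) auto
  then show ?thesis by (simp add: G_def algebra_simps)
qed

section \<open>Random perfect matchings\<close>

locale edge_weights =
  fixes r n k :: nat and h :: "nat set \<Rightarrow> nat \<Rightarrow> real"
  assumes r: "1 \<le> r"
    and h_norm: "\<And>e. e \<in> complete_hypergraph r (r * n) \<Longrightarrow> l1_norm k (h e) \<le> 1"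
begin

text \<open>The fixed matching lives on positions, and a permutation sends positions to vertices.
  Exchanging vertices between edges is therefore composition on the right.\<close>

definition edge_pos :: "nat \<Rightarrow> nat set" where
  "edge_pos e = {r * e..<r * e + r}"

definition matching_sum :: "(nat \<Rightarrow> nat) \<Rightarrow> nat \<Rightarrow> real" where
  "matching_sum \<pi> i = (\<Sum>e<n. h (\<pi> ` edge_pos e) i)"

text \<open>Pair \<open>j\<close> consists of the edges 2j and 2j + 1, and the transposed positions
  are their first ones. For odd \<open>n\<close> the last edge belongs to no pair with
  \<open>j < n div 2\<close>.\<close>

definition swap_diff :: "(nat \<Rightarrow> nat) \<Rightarrow> nat \<Rightarrow> nat \<Rightarrow> real" where
  "swap_diff \<pi> j i = matching_sum (\<pi> \<circ> transpose (2 * r * j) (2 * r * j + r)) i - matching_sum \<pi> i"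

text \<open>
  The effect of exchanging \<open>x 0\<close> and \<open>x r\<close> between the edges \<open>x ` {0..<r}\<close> and \<open>x ` {r..<2 * r}\<close>.
\<close>

definition exchange :: "(nat \<Rightarrow> nat) \<Rightarrow> nat \<Rightarrow> real" where
  "exchange x i = h (x ` insert r {1..<r}) i + h (x ` insert 0 {r+1..<2*r}) i
     - h (x ` {0..<r}) i - h (x ` {r..<2*r}) i"

text \<open>The target e(M) / e(G) h(G), with e(M) = \<open>n\<close> for every perfect
  matching.\<close>

definition mean_sum :: "nat \<Rightarrow> real" where
  "mean_sum i = real n / real (card (complete_hypergraph r (r * n))) *
     edge_sum h (complete_hypergraph r (r * n)) i"

section \<open>Positions of the edges and exchanges between them\<close>

lemma edge_pos_disjoint: "e \<noteq> e' \<Longrightarrow> edge_pos e \<inter> edge_pos e' = {}"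
proof (induction e e' rule: linorder_wlog)
  case (le e e')
  then have "r * (e + 1) \<le> r * e'" by (intro mult_left_mono) auto
  then show ?case by (auto simp: edge_pos_def)
qed (simp add: Int_commute)

lemma edge_pos_subset: "e < n \<Longrightarrow> edge_pos e \<subseteq> {..<r * n}"
proof -
  assume "e < n"
  then have "r * (e + 1) \<le> r * n" by (intro mult_left_mono) auto
  then show ?thesis by (auto simp: edge_pos_def)
qed

lemma card_edge_pos: "card (edge_pos e) = r"
  by (simp add: edge_pos_def)

lemma mem_edge_pos_div: "p \<in> edge_pos (p div r)"
proof -
  have "p mod r < r" using r by simp
  then show ?thesis
    unfolding edge_pos_def atLeastLessThan_iff using mult_div_mod_eq[of r p] by linarith
qed

lemma Union_edge_pos: "(\<Union>e<n. edge_pos e) = {..<r * n}"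
proof
  show "(\<Union>e<n. edge_pos e) \<subseteq> {..<r * n}" using edge_pos_subset by blast
  show "{..<r * n} \<subseteq> (\<Union>e<n. edge_pos e)"
  proof
    fix p assume "p \<in> {..<r * n}"
    then have "p div r < n" by (simp add: less_mult_imp_div_less mult.commute)
    then show "p \<in> (\<Union>e<n. edge_pos e)" using mem_edge_pos_div by blast
  qed
qed

lemma exchange_cong:
  assumes "\<And>t. t < 2 * r \<Longrightarrow> x t = y t"
  shows "exchange x = exchange y"
proof -
  have img: "x ` A = y ` A" if "A \<subseteq> {..<2 * r}" for A
    using that assms by (intro image_cong) auto
  have "x ` insert r {1..<r} = y ` insert r {1..<r}"
    "x ` insert 0 {r+1..<2*r} = y ` insert 0 {r+1..<2*r}"
    "x ` {0..<r} = y ` {0..<r}" "x ` {r..<2*r} = y ` {r..<2*r}"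
    by (rule img; use r in force)+
  then show ?thesis by (intro ext) (simp only: exchange_def)
qed

text \<open>The list \<open>s\<close> puts the transposed positions at indices 0 and
  \<open>r\<close>; every edge other than \<open>e\<close> and \<open>e'\<close> is fixed. As
  \<open>s\<close> is arbitrary, any transposition between different edges is reduced to the
  standard exchange.\<close>

lemma matching_sum_transpose:
  assumes s: "inj_on s {..<2*r}" "s ` {0..<r} = edge_pos e" "s ` {r..<2*r} = edge_pos e'"
    and e: "e < n" "e' < n" "e \<noteq> e'"
  shows "matching_sum (\<pi> \<circ> transpose (s 0) (s r)) i - matching_sum \<pi> i = exchange (\<pi> \<circ> s) i"
proof -
  define \<tau> where "\<tau> = transpose (s 0) (s r)"
  have mem: "s 0 \<in> edge_pos e" "s r \<in> edge_pos e'" using r s(2,3) by (auto simp flip: s(2,3))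
  have fix_s: "\<tau> (s t) = s t" if "t < 2 * r" "t \<noteq> 0" "t \<noteq> r" for t
  proof -
    have "s t \<noteq> s 0" "s t \<noteq> s r" using that r by (simp_all add: inj_on_eq_iff[OF s(1)])
    then show ?thesis by (simp add: \<tau>_def)
  qed
  have "{0..<r} = insert 0 {1..<r}" "{r..<2*r} = insert r {r+1..<2*r}" using r by auto
  then have edges: "edge_pos e = insert (s 0) (s ` {1..<r})"
    "edge_pos e' = insert (s r) (s ` {r+1..<2*r})"
    by (simp_all flip: s(2,3))
  have fix_img: "\<tau> ` s ` A = s ` A" if "A \<subseteq> {..<2*r} - {0, r}" for A
  proof -
    have "\<tau> ` s ` A = (\<lambda>t. s t) ` A" unfolding image_image
      using that by (intro image_cong refl fix_s) auto
    then show ?thesis by simp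
  qed
  have img_e: "\<tau> ` edge_pos e = s ` insert r {1..<r}"
    unfolding edges using fix_img[of "{1..<r}"] by (simp add: \<tau>_def subset_iff)
  have img_e': "\<tau> ` edge_pos e' = s ` insert 0 {r+1..<2*r}"
    unfolding edges using fix_img[of "{r+1..<2*r}"] by (simp add: \<tau>_def subset_iff)
  have other: "\<tau> ` edge_pos c = edge_pos c" if "c \<noteq> e" "c \<noteq> e'" for c
  proof -
    have "s 0 \<notin> edge_pos c" "s r \<notin> edge_pos c"
      using mem edge_pos_disjoint[OF that(1)] edge_pos_disjoint[OF that(2)] by blast+
    then have "\<tau> ` edge_pos c = (\<lambda>x. x) ` edge_pos c"
      by (intro image_cong) (auto simp: \<tau>_def transpose_def)
    then show ?thesis by simp
  qed
  have "matching_sum (\<pi> \<circ> \<tau>) i - matching_sum \<pi> i =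
      (\<Sum>c<n. h (\<pi> ` \<tau> ` edge_pos c) i - h (\<pi> ` edge_pos c) i)"
    by (simp add: matching_sum_def image_comp sum_subtractf)
  also have "\<dots> = (\<Sum>c\<in>{e, e'}. h (\<pi> ` \<tau> ` edge_pos c) i - h (\<pi> ` edge_pos c) i)"
    using e other by (intro sum.mono_neutral_right) auto
  also have "\<dots> = exchange (\<pi> \<circ> s) i"
    unfolding exchange_def image_comp[symmetric] s(2,3) img_e[symmetric] img_e'[symmetric]
    using e(3) by simp
  finally show ?thesis by (simp add: \<tau>_def)
qed

lemma block_positions:
  assumes "j < n div 2"
  shows "(\<lambda>t. 2*r*j + t) ` {0..<r} = edge_pos (2 * j)"
    "(\<lambda>t. 2*r*j + t) ` {r..<2*r} = edge_pos (2 * j + 1)"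
    "2 * j + 1 < n" "2*r*j + 2*r \<le> r * n"
proof -
  show "(\<lambda>t. 2*r*j + t) ` {0..<r} = edge_pos (2 * j)"
    "(\<lambda>t. 2*r*j + t) ` {r..<2*r} = edge_pos (2 * j + 1)"
    by (simp_all add: edge_pos_def algebra_simps)
  show "2 * j + 1 < n" using assms by linarith
  then have "r * (2 * j + 2) \<le> r * n" by (intro mult_left_mono) auto
  then show "2*r*j + 2*r \<le> r * n" by (simp add: algebra_simps)
qed

lemma swap_diff_eq_exchange:
  assumes "j < n div 2"
  shows "swap_diff \<pi> j = exchange (\<lambda>t. \<pi> (j * (2 * r) + t))"
proof
  fix i
  show "swap_diff \<pi> j i = exchange (\<lambda>t. \<pi> (j * (2 * r) + t)) i"
    using matching_sum_transpose[of "\<lambda>t. 2*r*j + t" "2 * j" "2 * j + 1" \<pi> i] block_positions[OF assms]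
    by (simp add: swap_diff_def o_def mult.commute mult.left_commute)
qed

lemma exchange_norm:
  assumes x: "inj_on x {..<2*r}" "x ` {..<2*r} \<subseteq> {..<r * n}"
  shows "l1_norm k (exchange x) \<le> 4"
proof -
  have edge: "l1_norm k (h (x ` A)) \<le> 1" if "A \<subseteq> {..<2*r}" "card A = r" for A
  proof (rule h_norm)
    have "inj_on x A" using x(1) that(1) by (rule inj_on_subset)
    moreover have "x ` A \<subseteq> {..<r * n}" using x(2) that(1) by blast
    moreover have "finite A" using that(1) finite_subset by blast
    ultimately show "x ` A \<in> complete_hypergraph r (r * n)"
      using that(2) by (simp add: complete_hypergraph_def nsets_def card_image)
  qed
  have "l1_norm k (exchange x) \<le> l1_norm k (h (x ` insert r {1..<r})) + l1_norm k (h (x ` insert 0 {r+1..<2*r}))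
      + l1_norm k (h (x ` {0..<r})) + l1_norm k (h (x ` {r..<2*r}))"
    unfolding exchange_def[abs_def] l1_norm_def sum.distrib[symmetric] by (intro sum_mono) linarith
  moreover have "l1_norm k (h (x ` insert r {1..<r})) \<le> 1" using r by (intro edge) auto
  moreover have "l1_norm k (h (x ` insert 0 {r+1..<2*r})) \<le> 1" using r by (intro edge) auto
  moreover have "l1_norm k (h (x ` {0..<r})) \<le> 1" using r by (intro edge) auto
  moreover have "l1_norm k (h (x ` {r..<2*r})) \<le> 1" using r by (intro edge) auto
  ultimately show ?thesis by linarith
qed

lemma swap_diff_norm:
  assumes "\<pi> permutes {..<r * n}" "j < n div 2"
  shows "l1_norm k (swap_diff \<pi> j) \<le> 4"
  unfolding swap_diff_eq_exchange[OF assms(2)]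
proof (rule exchange_norm)
  show "inj_on (\<lambda>t. \<pi> (j * (2 * r) + t)) {..<2*r}"
    by (rule inj_onI, drule injD[OF permutes_inj[OF assms(1)]], simp)
  have "\<pi> (j * (2 * r) + t) < r * n" if "t < 2 * r" for t
  proof -
    have "j * (2 * r) = 2 * r * j" by simp
    then have "j * (2 * r) + t \<in> {..<r * n}"
      using block_positions(4)[OF assms(2)] that unfolding lessThan_iff by linarith
    then have "\<pi> (j * (2 * r) + t) \<in> {..<r * n}"
      by (simp only: permutes_in_image[OF assms(1)])
    then show ?thesis by simp
  qed
  then show "(\<lambda>t. \<pi> (j * (2 * r) + t)) ` {..<2*r} \<subseteq> {..<r * n}" by auto
qed

text \<open>By symmetry all r-sets of positions have the same average. Their total is
  \<open>edge_sum\<close> for each permutation, which merely permutes the hyperedges.\<close>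

lemma perm_avg_matching_sum: "perm_avg (r * n) (\<lambda>\<pi>. matching_sum \<pi> i) = mean_sum i"
proof -
  define H where "H = complete_hypergraph r (r * n)"
  have edge_avg: "perm_avg (r * n) (\<lambda>\<pi>. h (\<pi> ` A) i) = perm_avg (r * n) (\<lambda>\<pi>. h (\<pi> ` A') i)"
    if A: "A \<in> H" "A' \<in> H" for A A'
  proof -
    have fin: "finite A" "card A = r" "A \<subseteq> {..<r*n}" "finite A'" "card A' = r" "A' \<subseteq> {..<r*n}"
      using A by (auto simp: H_def complete_hypergraph_def nsets_def)
    obtain s where s: "bij_betw s {0..<r} A" using ex_bij_betw_nat_finite[of A] fin by auto
    obtain s' where s': "bij_betw s' {0..<r} A'" using ex_bij_betw_nat_finite[of A'] fin by auto
    have "perm_avg (r * n) (\<lambda>\<pi>. (\<lambda>x. h (x ` {0..<r}) i) (\<pi> \<circ> s)) =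
        perm_avg (r * n) (\<lambda>\<pi>. (\<lambda>x. h (x ` {0..<r}) i) (\<pi> \<circ> s'))"
    proof (rule perm_avg_injection_cong[where A = "{0..<r}"])
      show "h (x ` {0..<r}) i = h (y ` {0..<r}) i" if "\<And>t. t \<in> {0..<r} \<Longrightarrow> x t = y t" for x y :: "nat \<Rightarrow> nat"
        by (rule arg_cong[where f = "\<lambda>B. h B i"], rule image_cong[OF refl that])
    qed (use s s' fin in \<open>auto simp: bij_betw_def\<close>)
    then show ?thesis
      by (simp only: image_comp[symmetric] bij_betw_imp_surj_on[OF s] bij_betw_imp_surj_on[OF s'])
  qed
  have finH: "finite H" unfolding H_def complete_hypergraph_def by (simp add: finite_imp_finite_nsets)
  have E: "edge_pos e \<in> H" if "e < n" for e
    using edge_pos_subset[OF that] card_edge_pos[of e]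
    by (simp add: H_def complete_hypergraph_def nsets_def edge_pos_def)
  have one: "perm_avg (r * n) (\<lambda>\<pi>. h (\<pi> ` edge_pos e) i) = edge_sum h H i / real (card H)" if "e < n" for e
  proof -
    have "(\<Sum>A\<in>H. perm_avg (r * n) (\<lambda>\<pi>. h (\<pi> ` A) i)) =
        (\<Sum>A\<in>H. perm_avg (r * n) (\<lambda>\<pi>. h (\<pi> ` edge_pos e) i))"
      by (intro sum.cong refl edge_avg E that)
    then have "(\<Sum>A\<in>H. perm_avg (r * n) (\<lambda>\<pi>. h (\<pi> ` A) i)) =
        real (card H) * perm_avg (r * n) (\<lambda>\<pi>. h (\<pi> ` edge_pos e) i)"
      by simp
    moreover have "(\<Sum>A\<in>H. perm_avg (r * n) (\<lambda>\<pi>. h (\<pi> ` A) i)) = edge_sum h H i"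
    proof -
      have "(\<Sum>A\<in>H. h (\<pi> ` A) i) = edge_sum h H i" if "\<pi> permutes {..<r * n}" for \<pi>
      proof -
        have "bij_betw (\<lambda>A. \<pi> ` A) H H"
          unfolding H_def complete_hypergraph_def
          using permutes_imp_bij[OF that] by (rule bij_betw_nsets)
        then show ?thesis unfolding edge_sum_def by (rule sum.reindex_bij_betw)
      qed
      then have "perm_avg (r * n) (\<lambda>\<pi>. \<Sum>A\<in>H. h (\<pi> ` A) i) = perm_avg (r * n) (\<lambda>_. edge_sum h H i)"
        by (rule perm_avg_cong)
      then show ?thesis by (simp add: perm_avg_sum)
    qed
    moreover have "card H > 0" using E[OF that] finH by (auto simp: card_gt_0_iff)
    ultimately show ?thesis by (simp add: field_simps)
  qed
  have "perm_avg (r * n) (\<lambda>\<pi>. matching_sum \<pi> i) = (\<Sum>e<n. perm_avg (r * n) (\<lambda>\<pi>. h (\<pi> ` edge_pos e) i))"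
    unfolding matching_sum_def by (rule perm_avg_sum)
  also have "\<dots> = (\<Sum>e<n. edge_sum h H i / real (card H))" using one by simp
  finally show ?thesis by (simp add: mean_sum_def H_def)
qed

section \<open>Both variances in terms of the mean square of an exchange\<close>

definition swap_energy :: "(nat \<Rightarrow> real) \<Rightarrow> real" where
  "swap_energy u = perm_avg (r * n) (\<lambda>\<pi>. (dot k u (exchange \<pi>))\<^sup>2)"

lemma swap_energy_nonneg: "0 \<le> swap_energy u"
  unfolding swap_energy_def by (intro perm_avg_nonneg) auto

text \<open>All exchanges share one law, since any list of 2r distinct positions may replace the
  first 2r; \<open>2 \<le> n\<close> ensures that these exist.\<close>

lemma perm_avg_exchange:
  assumes "inj_on s {..<2*r}" "s ` {..<2*r} \<subseteq> {..<r * n}" "2 \<le> n"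
  shows "perm_avg (r * n) (\<lambda>\<pi>. f (exchange (\<pi> \<circ> s))) = perm_avg (r * n) (\<lambda>\<pi>. f (exchange \<pi>))"
proof -
  have "2 * r \<le> r * n" using mult_left_mono[OF assms(3), of r] by (simp add: mult.commute)
  then have "perm_avg (r * n) (\<lambda>\<pi>. (\<lambda>x. f (exchange x)) (\<pi> \<circ> s)) =
      perm_avg (r * n) (\<lambda>\<pi>. (\<lambda>x. f (exchange x)) (\<pi> \<circ> id))"
    using assms
    by (intro perm_avg_injection_cong[where A = "{..<2*r}"])
      (auto intro!: arg_cong[where f = f] exchange_cong)
  then show ?thesis by simp
qed

lemma perm_avg_swap_diff:
  assumes "j < n div 2"
  shows "perm_avg (r * n) (\<lambda>\<pi>. f (swap_diff \<pi> j)) = perm_avg (r * n) (\<lambda>\<pi>. f (exchange \<pi>))"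
proof -
  have "perm_avg (r * n) (\<lambda>\<pi>. f (exchange (\<pi> \<circ> (\<lambda>t. j * (2 * r) + t)))) =
      perm_avg (r * n) (\<lambda>\<pi>. f (exchange \<pi>))"
  proof (rule perm_avg_exchange)
    have eq: "j * (2 * r) = 2 * r * j" by simp
    show "(\<lambda>t. j * (2 * r) + t) ` {..<2 * r} \<subseteq> {..<r * n}"
      unfolding eq using block_positions(4)[OF assms] by auto
  qed (use assms in \<open>auto simp: inj_on_def\<close>)
  then show ?thesis by (simp add: swap_diff_eq_exchange[OF assms] o_def)
qed

lemma positions_listing:
  assumes "p \<in> edge_pos e" "p' \<in> edge_pos e'" "e < n" "e' < n" "e \<noteq> e'"
  obtains s where "inj_on s {..<2*r}" "s ` {0..<r} = edge_pos e" "s ` {r..<2*r} = edge_pos e'"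
    "s 0 = p" "s r = p'"
proof -
  \<comment> \<open>Swapping \<open>p\<close> with the first position of its edge brings it to index
    0 and keeps the edge as a set; \<open>p'\<close> is likewise brought to index
    \<open>r\<close>.\<close>
  define s where "s t = (if t < r then transpose p (r * e) (r * e + t)
    else transpose p' (r * e') (r * e' + (t - r)))" for t
  have base: "r * c \<in> edge_pos c" for c using r by (simp add: edge_pos_def)
  have tr: "transpose q (r * c) ` edge_pos c = edge_pos c" if "q \<in> edge_pos c" for q c
    using permutes_image[OF permutes_swap_id[OF that base]] .
  have "s ` {0..<r} = transpose p (r * e) ` (\<lambda>t. r * e + t) ` {0..<r}"
    unfolding image_image by (intro image_cong) (auto simp: s_def)
  also have "(\<lambda>t. r * e + t) ` {0..<r} = edge_pos e" by (simp add: edge_pos_def add.commute)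
  finally have 1: "s ` {0..<r} = edge_pos e" using tr[OF assms(1)] by simp
  have "s ` {r..<2*r} = transpose p' (r * e') ` (\<lambda>t. r * e' + t) ` (\<lambda>t. t - r) ` {r..<2*r}"
    unfolding image_image by (intro image_cong) (auto simp: s_def)
  also have "(\<lambda>t. t - r) ` {r..<2*r} = {0..<r}"
    by (force simp: image_iff intro: bexI[where x = "_ + r"])
  also have "(\<lambda>t. r * e' + t) ` {0..<r} = edge_pos e'" by (simp add: edge_pos_def add.commute)
  finally have 2: "s ` {r..<2*r} = edge_pos e'" using tr[OF assms(2)] by simp
  have split: "{..<2*r} = {0..<r} \<union> {r..<2*r}" using r by auto
  have "card (s ` {..<2*r}) = card (edge_pos e \<union> edge_pos e')"
    unfolding split image_Un 1 2 ..
  also have "\<dots> = r + r"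
    using edge_pos_disjoint[OF assms(5)] by (subst card_Un_disjoint) (auto simp: edge_pos_def)
  finally have "inj_on s {..<2*r}" by (intro eq_card_imp_inj_on) auto
  then show thesis using that[OF _ 1 2] r by (simp add: s_def)
qed

text \<open>A transposition inside an edge does not change the matching, and one between two edges
  has mean square \<open>swap_energy u\<close>, so the spectral gap applies with this
  constant.\<close>

lemma matching_sum_variance:
  assumes "2 \<le> n"
  shows "perm_avg (r * n) (\<lambda>\<pi>. (dot k u (\<lambda>i. matching_sum \<pi> i - mean_sum i))\<^sup>2) \<le> real (r * n) * swap_energy u"
proof -
  define f where "f \<pi> = dot k u (matching_sum \<pi>)" for \<pi>
  have mean: "perm_avg (r * n) f = dot k u mean_sum"
    unfolding f_def[abs_def] dot_def perm_avg_sum perm_avg_cmult perm_avg_matching_sum ..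
  have "perm_avg (r * n) (\<lambda>\<pi>. (f \<pi> - perm_avg (r * n) f)\<^sup>2) \<le> real (r * n) * swap_energy u"
  proof (rule perm_avg_variance_le)
    fix p p' assume p: "p < p'" "p' < r * n"
    define e e' where "e = p div r" and "e' = p' div r"
    have mem: "p \<in> edge_pos e" "p' \<in> edge_pos e'"
      unfolding e_def e'_def by (rule mem_edge_pos_div)+
    have lt: "e < n" "e' < n"
      using p by (auto simp: e_def e'_def less_mult_imp_div_less mult.commute)
    show "perm_avg (r * n) (\<lambda>\<pi>. (f \<pi> - f (\<pi> \<circ> transpose p p'))\<^sup>2) \<le> swap_energy u"
    proof (cases "e = e'")
      case True
      have "transpose p p' ` edge_pos c = edge_pos c" for c
      proof (cases "c = e")
        case True
        with mem \<open>e = e'\<close> show ?thesis using permutes_image[OF permutes_swap_id[of p "edge_pos c" p']] by simp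
      next
        case False
        then have "p \<notin> edge_pos c" "p' \<notin> edge_pos c"
          using mem \<open>e = e'\<close> edge_pos_disjoint[of c e] by auto
        then have "transpose p p' ` edge_pos c = (\<lambda>x. x) ` edge_pos c"
          by (intro image_cong) (auto simp: transpose_def)
        then show ?thesis by simp
      qed
      then have "matching_sum (\<pi> \<circ> transpose p p') = matching_sum \<pi>" for \<pi>
        by (intro ext) (simp only: matching_sum_def image_comp[symmetric])
      then show ?thesis using swap_energy_nonneg by (simp add: f_def)
    next
      case False
      obtain s where s: "inj_on s {..<2*r}" "s ` {0..<r} = edge_pos e" "s ` {r..<2*r} = edge_pos e'"
        "s 0 = p" "s r = p'"
        using positions_listing[OF mem lt False] by blast
      have "f (\<pi> \<circ> transpose p p') - f \<pi> = dot k u (exchange (\<pi> \<circ> s))" for \<pi>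
        using matching_sum_transpose[OF s(1-3) lt False, of \<pi>] s(4,5)
        by (simp add: f_def flip: dot_diff_right)
      then have "(f \<pi> - f (\<pi> \<circ> transpose p p'))\<^sup>2 = (dot k u (exchange (\<pi> \<circ> s)))\<^sup>2" for \<pi>
        by (metis power2_commute)
      then have "perm_avg (r * n) (\<lambda>\<pi>. (f \<pi> - f (\<pi> \<circ> transpose p p'))\<^sup>2) =
          perm_avg (r * n) (\<lambda>\<pi>. (dot k u (exchange (\<pi> \<circ> s)))\<^sup>2)" by simp
      also have "\<dots> = swap_energy u"
        unfolding swap_energy_def
      proof (rule perm_avg_exchange[OF s(1) _ assms])
        have "{..<2*r} = {0..<r} \<union> {r..<2*r}" using r by auto
        then have "s ` {..<2*r} = edge_pos e \<union> edge_pos e'" by (simp only: image_Un s(2,3))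
        then show "s ` {..<2*r} \<subseteq> {..<r * n}" using edge_pos_subset lt by simp
      qed
      finally show ?thesis by simp
    qed
  qed (rule swap_energy_nonneg)
  then show ?thesis unfolding mean by (simp add: f_def dot_diff_right)
qed

text \<open>Needed for two kinds of \<open>g\<close>: the linear functional \<open>dot k u\<close>,
  for the sum of all exchanges, and a product of two such functionals, for the entries of the Gram
  form.\<close>

lemma block_sum_variance:
  fixes g :: "(nat \<Rightarrow> real) \<Rightarrow> real"
  defines "T \<equiv> \<lambda>\<pi>. \<Sum>j<n div 2. g (swap_diff \<pi> j)"
  shows "perm_avg (r * n) (\<lambda>\<pi>. (T \<pi> - perm_avg (r * n) T)\<^sup>2) \<le>
    16 * real (r * n) * perm_avg (r * n) (\<lambda>\<pi>. (g (exchange \<pi>))\<^sup>2)"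
proof -
  have T: "T = (\<lambda>\<pi>. \<Sum>j<n div 2. g (exchange (\<lambda>t. \<pi> (j * (2 * r) + t))))"
    by (simp add: T_def swap_diff_eq_exchange)
  have "n div 2 * (2 * r) = (n div 2 * 2) * r" by simp
  also have "\<dots> \<le> n * r" by (intro mult_right_mono) auto
  finally have "n div 2 * (2 * r) \<le> r * n" by (simp add: mult.commute)
  then show ?thesis
    unfolding T using r
    by (intro perm_avg_block_variance) (auto intro!: arg_cong[where f = g] exchange_cong)
qed

text \<open>The factor 3 is attained at n = 3, where one of three edges stays unpaired.\<close>

lemma positions_le_swaps:
  assumes "2 \<le> n"
  shows "real (r * n) \<le> 3 * real r * real (n div 2)"
proof -
  have "n \<le> 3 * (n div 2)" using assms by linarith
  then have "r * n \<le> r * (3 * (n div 2))" by (intro mult_left_mono) auto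
  then have "real (r * n) \<le> real (r * (3 * (n div 2)))" by (simp only: of_nat_le_iff)
  then show ?thesis by (simp add: algebra_simps)
qed

section \<open>Construction of the matching\<close>

text \<open>The last clause carries the induction: blocks outside \<open>K\<close> are untouched, so
  a later exchange still contributes the \<open>swap_diff\<close> of the original \<pi>.\<close>

lemma apply_swaps:
  assumes "\<pi> permutes {..<r * n}" "finite K" "K \<subseteq> {..<n div 2}"
  shows "\<exists>\<rho>. \<rho> permutes {..<r * n} \<and> (\<forall>i. matching_sum \<rho> i = matching_sum \<pi> i + (\<Sum>j\<in>K. swap_diff \<pi> j i)) \<and>
    (\<forall>j<n div 2. j \<notin> K \<longrightarrow> (\<forall>t<2*r. \<rho> (j * (2 * r) + t) = \<pi> (j * (2 * r) + t)))"
  using assms(2,3)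
proof (induction K rule: finite_induct)
  case empty
  then show ?case using assms(1) by auto
next
  case (insert j K)
  then obtain \<rho> where \<rho>: "\<rho> permutes {..<r * n}"
    "\<forall>i. matching_sum \<rho> i = matching_sum \<pi> i + (\<Sum>j\<in>K. swap_diff \<pi> j i)"
    "\<forall>j<n div 2. j \<notin> K \<longrightarrow> (\<forall>t<2*r. \<rho> (j * (2 * r) + t) = \<pi> (j * (2 * r) + t))"
    by auto
  have j: "j < n div 2" using insert.prems by simp
  define \<tau> where "\<tau> = transpose (2 * r * j) (2 * r * j + r)"
  have lt: "2 * r * j + r < r * n" "2 * r * j < r * n"
    using block_positions(4)[OF j] r by linarith+
  have "\<tau> permutes {..<r * n}"
    unfolding \<tau>_def using lt by (intro permutes_swap_id) auto
  then have perm: "\<rho> \<circ> \<tau> permutes {..<r * n}"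
    using \<rho>(1) by (rule permutes_compose)
  have "swap_diff \<rho> j = swap_diff \<pi> j"
    unfolding swap_diff_eq_exchange[OF j] using \<rho>(3) j insert.hyps(2) by (intro exchange_cong) auto
  then have "matching_sum (\<rho> \<circ> \<tau>) i = matching_sum \<rho> i + swap_diff \<pi> j i" for i
    by (metis \<tau>_def add.commute diff_add_cancel swap_diff_def)
  then have sum: "matching_sum (\<rho> \<circ> \<tau>) i = matching_sum \<pi> i + (\<Sum>j\<in>insert j K. swap_diff \<pi> j i)" for i
    using \<rho>(2) insert.hyps by simp
  have "(\<rho> \<circ> \<tau>) (j' * (2 * r) + t) = \<pi> (j' * (2 * r) + t)"
    if "j' < n div 2" "j' \<notin> insert j K" "t < 2 * r" for j' t
  proof -
    have div: "(j' * (2 * r) + t) div (2 * r) = j'" using that(3) by simp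
    have "(2 * r * j) div (2 * r) = j" "(2 * r * j + r) div (2 * r) = j" using r by simp_all
    then have "j' * (2 * r) + t \<noteq> 2 * r * j" "j' * (2 * r) + t \<noteq> 2 * r * j + r"
      using div that(2) by auto
    then have "\<tau> (j' * (2 * r) + t) = j' * (2 * r) + t" by (simp add: \<tau>_def)
    then show ?thesis using \<rho>(3) that by simp
  qed
  then show ?case using perm sum by blast
qed

lemma approximating_permutation:
  assumes "2 \<le> n" "1 \<le> k"
  obtains \<rho> where "\<rho> permutes {..<r * n}"
    "l1_norm k (\<lambda>i. matching_sum \<rho> i - mean_sum i) \<le> 1524 * real r * (real k)\<^sup>2"
proof -
  define m where "m = n div 2"
  \<comment> \<open>\<open>subset_sum_approx\<close> aims at \<open>err\<close> plus half of the
    total exchange, which is then the full difference between \<open>mean_sum\<close> and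
    \<open>matching_sum\<close>.\<close>
  define err where "err \<pi> i = mean_sum i - matching_sum \<pi> i - (\<Sum>j<m. swap_diff \<pi> j i) / 2" for \<pi> i
  have r_pos: "0 < real r" using r by simp
  have rn: "real (r * n) \<le> 3 * real r * real m"
    unfolding m_def by (rule positions_le_swaps[OF assms(1)])
  have norm: "l1_norm k (swap_diff \<pi> j) \<le> 4" if "\<pi> permutes {..<r * n}" "j < m" for \<pi> j
    using swap_diff_norm that by (simp add: m_def)
  have err_bound: "perm_avg (r * n) (\<lambda>\<pi>. (dot k u (err \<pi>))\<^sup>2) \<le>
      30 * real r * (\<Sum>j<m. perm_avg (r * n) (\<lambda>\<pi>. (dot k u (swap_diff \<pi> j))\<^sup>2))" for u
  proof -
    define X where "X \<pi> = dot k u (\<lambda>i. matching_sum \<pi> i - mean_sum i)" for \<pi>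
    define T where "T = (\<lambda>\<pi>. \<Sum>j<m. dot k u (swap_diff \<pi> j))"
    \<comment> \<open>The transposed permutation has the same law, so an exchange has mean zero and
      the variance of \<open>T\<close> is its second moment.\<close>
    have "perm_avg (r * n) (\<lambda>\<pi>. dot k u (swap_diff \<pi> j)) = 0" if "j < m" for j
    proof -
      have "2 * r * j < r * n" "2 * r * j + r < r * n"
        using block_positions(4)[of j] that r by (simp_all add: m_def)
      then have "transpose (2 * r * j) (2 * r * j + r) permutes {..<r * n}"
        by (intro permutes_swap_id) auto
      from perm_avg_compose_right[OF this, of "\<lambda>\<pi>. dot k u (matching_sum \<pi>)"]
      show ?thesis
        by (simp add: swap_diff_def[abs_def] dot_diff_right perm_avg_diff)
    qed
    then have "perm_avg (r * n) T = 0" by (simp add: T_def perm_avg_sum)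
    then have T: "perm_avg (r * n) (\<lambda>\<pi>. (T \<pi>)\<^sup>2) \<le> 16 * real (r * n) * swap_energy u"
      using block_sum_variance[of "dot k u"] by (simp add: T_def m_def swap_energy_def)
    have X: "perm_avg (r * n) (\<lambda>\<pi>. (X \<pi>)\<^sup>2) \<le> real (r * n) * swap_energy u"
      unfolding X_def by (rule matching_sum_variance[OF assms(1)])
    have dot_err: "dot k u (err \<pi>) = - (X \<pi> + 1/2 * T \<pi>)" for \<pi>
    proof -
      have "err \<pi> = (\<lambda>i. (- 1) * (matching_sum \<pi> i - mean_sum i) - 1/2 * (\<Sum>j<m. swap_diff \<pi> j i))"
        by (simp add: err_def fun_eq_iff)
      then show ?thesis
        unfolding X_def T_def by (simp only: dot_diff_right dot_scale_right dot_sum_right) simp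
    qed
    \<comment> \<open>With the bounds \<open>X\<close> and \<open>T\<close> this gives 2 * 1 + 16 /
      2 = 10, and \<open>rn\<close> turns 10 into 30.\<close>
    have "(dot k u (err \<pi>))\<^sup>2 \<le> 2 * (X \<pi>)\<^sup>2 + 1/2 * (T \<pi>)\<^sup>2" for \<pi>
      unfolding dot_err using zero_le_power2[of "X \<pi> - 1/2 * T \<pi>"]
      by (simp add: power2_eq_square algebra_simps)
    then have "perm_avg (r * n) (\<lambda>\<pi>. (dot k u (err \<pi>))\<^sup>2) \<le>
        perm_avg (r * n) (\<lambda>\<pi>. 2 * (X \<pi>)\<^sup>2 + 1/2 * (T \<pi>)\<^sup>2)"
      by (intro perm_avg_mono)
    also have "\<dots> = 2 * perm_avg (r * n) (\<lambda>\<pi>. (X \<pi>)\<^sup>2) + 1/2 * perm_avg (r * n) (\<lambda>\<pi>. (T \<pi>)\<^sup>2)"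
      by (simp only: perm_avg_add perm_avg_cmult)
    also have "\<dots> \<le> 10 * (real (r * n) * swap_energy u)" using X T by linarith
    also have "\<dots> \<le> 10 * (3 * real r * real m * swap_energy u)"
      using rn swap_energy_nonneg by (intro mult_left_mono mult_right_mono) auto
    also have "\<dots> = 30 * real r * (\<Sum>j<m. swap_energy u)" by simp
    also have "(\<Sum>j<m. swap_energy u) = (\<Sum>j<m. perm_avg (r * n) (\<lambda>\<pi>. (dot k u (swap_diff \<pi> j))\<^sup>2))"
      unfolding swap_energy_def m_def
      by (intro sum.cong refl perm_avg_swap_diff[symmetric, where f = "\<lambda>x. (dot k u x)\<^sup>2"]) auto
    finally show ?thesis .
  qed
  have var_bound: "perm_avg (r * n) (\<lambda>\<pi>. ((\<Sum>j<m. dot k u (swap_diff \<pi> j) * dot k v (swap_diff \<pi> j)) -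
          perm_avg (r * n) (\<lambda>\<pi>. \<Sum>j<m. dot k u (swap_diff \<pi> j) * dot k v (swap_diff \<pi> j)))\<^sup>2) \<le>
        48 * real r * (\<Sum>j<m. perm_avg (r * n) (\<lambda>\<pi>. (dot k u (swap_diff \<pi> j))\<^sup>2 * (dot k v (swap_diff \<pi> j))\<^sup>2))"
    (is "?L \<le> _") for u v
  proof -
    define G where "G = perm_avg (r * n) (\<lambda>\<pi>. (dot k u (exchange \<pi>))\<^sup>2 * (dot k v (exchange \<pi>))\<^sup>2)"
    have "G \<ge> 0" unfolding G_def by (intro perm_avg_nonneg) auto
    have "?L \<le> 16 * real (r * n) * G"
      using block_sum_variance[of "\<lambda>x. dot k u x * dot k v x"] by (simp add: G_def m_def power_mult_distrib)
    also have "\<dots> \<le> 16 * (3 * real r * real m) * G"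
      using rn \<open>G \<ge> 0\<close> by (intro mult_left_mono mult_right_mono) auto
    also have "\<dots> = 48 * real r * (\<Sum>j<m. G)" by simp
    also have "(\<Sum>j<m. G) = (\<Sum>j<m. perm_avg (r * n) (\<lambda>\<pi>. (dot k u (swap_diff \<pi> j))\<^sup>2 * (dot k v (swap_diff \<pi> j))\<^sup>2))"
      unfolding G_def m_def
      by (intro sum.cong refl perm_avg_swap_diff[symmetric, where f = "\<lambda>x. (dot k u x)\<^sup>2 * (dot k v x)\<^sup>2"]) auto
    finally show ?thesis .
  qed
  obtain \<pi> where \<pi>: "\<pi> permutes {..<r * n}"
    "\<And>v. dot k v (err \<pi>) - (\<Sum>j<m. (dot k v (swap_diff \<pi> j))\<^sup>2) \<le>
        45 * real r * k + 9216 * real r * k * dot k v v"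
    using uniform_form_bound[OF r_pos assms(2) norm err_bound var_bound] by blast
  \<comment> \<open>189 = 45 + 9216 / 64, as \<open>dot k v v\<close> is at most k / 64 on the
    box.\<close>
  define B where "B = 189 * real r * (real k)\<^sup>2"
  have k_sq: "real k \<le> (real k)\<^sup>2" using assms(2) by (simp add: power2_eq_square)
  have "dot k v (err \<pi>) - (\<Sum>j\<in>{..<m}. (dot k v (swap_diff \<pi> j))\<^sup>2) \<le> B"
    if v: "\<And>i. i < k \<Longrightarrow> \<bar>v i\<bar> \<le> 1/8" for v
  proof -
    have "dot k v v \<le> (\<Sum>i<k. 1/64)"
      unfolding dot_def
    proof (rule sum_mono)
      fix i assume "i \<in> {..<k}"
      then have "\<bar>v i\<bar> * \<bar>v i\<bar> \<le> 1/8 * (1/8)" using v by (intro mult_mono) auto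
      then show "v i * v i \<le> 1/64" by simp
    qed
    then have "9216 * real r * k * dot k v v \<le> 9216 * real r * k * (real k / 64)"
      by (intro mult_left_mono) auto
    also have "\<dots> = 144 * (real r * (real k)\<^sup>2)" by (simp add: power2_eq_square)
    finally have "9216 * real r * k * dot k v v \<le> 144 * (real r * (real k)\<^sup>2)" .
    moreover have "real r * k \<le> real r * (real k)\<^sup>2" using k_sq by (intro mult_left_mono) auto
    moreover have "45 * real r * k = 45 * (real r * k)" "B = 189 * (real r * (real k)\<^sup>2)"
      by (simp_all add: B_def)
    ultimately show ?thesis using \<pi>(2)[of v] by linarith
  qed
  then obtain K where K: "K \<subseteq> {..<m}"
    "l1_norm k (\<lambda>i. (\<Sum>j\<in>K. swap_diff \<pi> j i) - (err \<pi> i + (\<Sum>j\<in>{..<m}. swap_diff \<pi> j i) / 2))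
       \<le> 8 * (B + 1) + 4 * real k"
    using subset_sum_approx[of "{..<m}" k "swap_diff \<pi>" "err \<pi>" B] norm[OF \<pi>(1)] by auto
  obtain \<rho> where \<rho>: "\<rho> permutes {..<r * n}"
    "\<forall>i. matching_sum \<rho> i = matching_sum \<pi> i + (\<Sum>j\<in>K. swap_diff \<pi> j i)"
    using apply_swaps[OF \<pi>(1), of K] K(1) finite_subset[OF K(1)] by (auto simp: m_def)
  have "(\<Sum>j\<in>K. swap_diff \<pi> j i) - (err \<pi> i + (\<Sum>j\<in>{..<m}. swap_diff \<pi> j i) / 2) =
      matching_sum \<rho> i - mean_sum i" for i
    using \<rho>(2) by (simp add: err_def)
  with K(2) have "l1_norm k (\<lambda>i. matching_sum \<rho> i - mean_sum i) \<le> 8 * (B + 1) + 4 * real k" by simp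
  also have "\<dots> \<le> 1524 * real r * (real k)\<^sup>2"
  proof -
    \<comment> \<open>1524 = 8 * 189 + 8 + 4, because 1 and \<open>real k\<close> are at most
      \<open>x\<close>.\<close>
    define x where "x = real r * (real k)\<^sup>2"
    have "1 * (real k)\<^sup>2 \<le> x" unfolding x_def using r by (intro mult_right_mono) auto
    then have "real k \<le> x" using order_trans[OF k_sq, of x] by simp
    moreover from this have "1 \<le> x" using assms(2) by linarith
    ultimately have "1512 * x + 8 * 1 + 4 * real k \<le> 1512 * x + 8 * x + 4 * x"
      by (intro add_mono mult_left_mono) auto
    moreover have "B = 189 * x" by (simp add: B_def x_def)
    ultimately have "8 * (B + 1) + 4 * real k \<le> 1524 * x" by simp
    then show ?thesis by (simp add: x_def mult.assoc)
  qed
  finally show thesis using that \<rho>(1) by blast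
qed

lemma matching_of_permutation:
  assumes "\<rho> permutes {..<r * n}"
  defines "M \<equiv> (\<lambda>e. \<rho> ` edge_pos e) ` {..<n}"
  shows "perfect_matching {..<r * n} (complete_hypergraph r (r * n)) M"
    and "discrepancy k h (complete_hypergraph r (r * n)) M = l1_norm k (\<lambda>i. matching_sum \<rho> i - mean_sum i)"
proof -
  have inj: "inj \<rho>" using assms(1) by (rule permutes_inj)
  have disj: "\<rho> ` edge_pos e \<inter> \<rho> ` edge_pos e' = {}" if "e \<noteq> e'" for e e'
    using edge_pos_disjoint[OF that] inj by (simp flip: image_Int)
  have nonempty: "\<rho> ` edge_pos e \<noteq> {}" for e using r by (simp add: edge_pos_def)
  have inj_edges: "inj_on (\<lambda>e. \<rho> ` edge_pos e) {..<n}"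
  proof (rule inj_onI)
    fix e e' assume "\<rho> ` edge_pos e = \<rho> ` edge_pos e'"
    then show "e = e'" using disj[of e e'] nonempty[of e] by auto
  qed
  have "M \<subseteq> complete_hypergraph r (r * n)"
  proof
    fix A assume "A \<in> M"
    then obtain e where e: "e < n" "A = \<rho> ` edge_pos e" by (auto simp: M_def)
    have "A \<subseteq> {..<r * n}"
      using image_mono[OF edge_pos_subset[OF e(1)], of \<rho>] permutes_image[OF assms(1)] e(2) by simp
    moreover have "card A = r"
      unfolding e(2) by (subst card_image) (auto simp: card_edge_pos intro: inj_on_subset[OF inj])
    moreover have "finite A" by (simp add: e(2) edge_pos_def)
    ultimately show "A \<in> complete_hypergraph r (r * n)"
      by (simp add: complete_hypergraph_def nsets_def)
  qed
  moreover have "disjoint M"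
  proof (rule disjointI)
    fix A B assume "A \<in> M" "B \<in> M" "A \<noteq> B"
    then obtain e e' where "A = \<rho> ` edge_pos e" "B = \<rho> ` edge_pos e'" "e \<noteq> e'"
      unfolding M_def by blast
    then show "A \<inter> B = {}" using disj by simp
  qed
  moreover have "\<Union>M = {..<r * n}"
  proof -
    have "\<Union>M = \<rho> ` (\<Union>e<n. edge_pos e)" by (auto simp: M_def)
    then show ?thesis using Union_edge_pos permutes_image[OF assms(1)] by simp
  qed
  ultimately show "perfect_matching {..<r * n} (complete_hypergraph r (r * n)) M"
    by (simp add: perfect_matching_def)
  have "card M = n" unfolding M_def using card_image[OF inj_edges] by simp
  moreover have "edge_sum h M i = matching_sum \<rho> i" for i
    unfolding edge_sum_def M_def matching_sum_def using sum.reindex[OF inj_edges] by simp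
  ultimately show "discrepancy k h (complete_hypergraph r (r * n)) M =
      l1_norm k (\<lambda>i. matching_sum \<rho> i - mean_sum i)"
    by (simp add: discrepancy_def mean_sum_def)
qed

end

theorem theorem1p6:
  fixes r :: nat
  assumes "r \<ge> 1"
  shows "\<exists>C::real. C > 0 \<and>
    (\<forall>(n::nat) (k::nat) (h :: nat set \<Rightarrow> nat \<Rightarrow> real).
       n \<ge> 1 \<longrightarrow> k \<ge> 1 \<longrightarrow>
       (\<forall>e \<in> complete_hypergraph r (r * n). l1_norm k (h e) \<le> 1) \<longrightarrow>
       (\<exists>M. perfect_matching {..<r * n} (complete_hypergraph r (r * n)) M \<and>
            discrepancy k h (complete_hypergraph r (r * n)) M \<le> C * (real k)\<^sup>2))"
proof (intro exI[of _ "1524 * real r"] conjI allI impI)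
  show "0 < 1524 * real r" using assms by simp
next
  fix n k :: nat and h :: "nat set \<Rightarrow> nat \<Rightarrow> real"
  assume n: "n \<ge> 1" and k: "k \<ge> 1"
    and h: "\<forall>e \<in> complete_hypergraph r (r * n). l1_norm k (h e) \<le> 1"
  show "\<exists>M. perfect_matching {..<r * n} (complete_hypergraph r (r * n)) M \<and>
    discrepancy k h (complete_hypergraph r (r * n)) M \<le> 1524 * real r * (real k)\<^sup>2"
  proof (cases "n = 1")
    \<comment> \<open>A single edge leaves nothing to pair; the hypergraph is its own perfect
      matching.\<close>
    case True
    then have "perfect_matching {..<r * n} (complete_hypergraph r (r * n)) (complete_hypergraph r (r * n))"
      "discrepancy k h (complete_hypergraph r (r * n)) (complete_hypergraph r (r * n)) = 0"
      by (simp_all add: perfect_matching_def discrepancy_def complete_hypergraph_def l1_norm_def)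
    then show ?thesis by (intro exI[of _ "complete_hypergraph r (r * n)"]) simp
  next
    case False
    interpret edge_weights r n k h
      using assms h by unfold_locales auto
    obtain \<rho> where \<rho>: "\<rho> permutes {..<r * n}"
      "l1_norm k (\<lambda>i. matching_sum \<rho> i - mean_sum i) \<le> 1524 * real r * (real k)\<^sup>2"
      using approximating_permutation False n k by (metis One_nat_def Suc_1 Suc_leI le_neq_implies_less)
    show ?thesis
      using matching_of_permutation[OF \<rho>(1)] \<rho>(2) by auto
  qed
qed

end
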